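(* Let $n\ge 1$, $1\le s\le n$, $m>0$, $\mu>0$, and let $\mathcal{C}$ be a symmetric class of subsets of $\{1,\ldots,n\}$, all of cardinality $s$, with $\Xi=\bigcup_{S\in\mathcal{C}}S$. Let $\mathcal{A}$ be any adaptive sensing strategy with total budget $m$, let $D=\{Y_i,A_i,\Gamma_i\}_{i\in\mathbb{N}}$ be the resulting data, and let $\hat\Phi=\hat\Phi(D)\in\{0,1\}$ be an arbitrary testing procedure. Let $0<\epsilon<1$. If $$R(\hat\Phi)=\mathbb{P}_\emptyset(\hat\Phi\neq 0)+\max_{S\in\mathcal{C}}\mathbb{P}_S(\hat\Phi\neq 1)\le\epsilon,$$ then necessarily the signal magnitude $x_{\min}=\mu$ satisfies $$x_{\min}\ \ge\ \sqrt{\frac{2|\Xi|}{sm}\log\frac{1}{2\epsilon}}.$$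
   Context: Signal model: for $S\subseteq\{1,\ldots,n\}$ the signal $\vec{x}\in\mathbb{R}^n$ with support $S$ is given by $x_i=\mu$ if $i\in S$ and $x_i=0$ otherwise; for $S\ne\emptyset$, $x_{\min}=\min\{|x_i|:x_i\neq0\}=\mu$. Adaptive sensing: one observes $Y_k=x_{A_k}+\Gamma_k^{-1}W_k$, $k=1,2,\ldots$, where $A_k\in\{1,\ldots,n\}$ is the entry measured at time $k$ and $\Gamma_k^2$ is the precision of that measurement. The pair $(A_k,\Gamma_k)$ is chosen as a (possibly randomized) function of the past $\{Y_i,A_i,\Gamma_i\}_{i=1}^{k-1}$; the $W_k$ are standard normal, each $W_k$ being independent of $\{Y_i\}_{i=1}^{k-1}$, $\{A_i,\Gamma_i\}_{i=1}^{k}$ (and of any extra randomization). The sensing strategy $\mathcal{A}$ is the collection of conditional distributions of $(A_k,\Gamma_k)$ given $\{Y_i,A_i,\Gamma_i\}_{i=1}^{k-1}$, for all $k$; it does not depend on the unknown $S$. The budget constraint is $\sum_{k=1}^\infty\Gamma_k^2\le m$ (almost surely). Convention: $\Gamma_k=0$ is allowed and means that no (informative) measurement is made at step $k$. $\mathbb{P}_S$ denotes the law of $D$ when the support is $S$. A test is a $\{0,1\}$-valued measurable function of $D$ (value 1 meaning that the null hypothesis $S=\emptyset$ is rejected in favour of $S\in\mathcal{C}$). Symmetric class: a nonempty class $\mathcal{C}$ of subsets of $\{1,\ldots,n\}$, all of cardinality $s$, such that for $S$ drawn uniformly at random from $\mathcal{C}$ one has $\mathbb{P}(i\in S)=s/|\Xi|$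 for all $i\in\Xi=\bigcup_{S\in\mathcal{C}}S$. If the quantity under the square root is negative, the lower bound is understood to be vacuous. *)

theory Defs
  imports "HOL-Probability.Probability"
begin

text \<open>Vectors of \<open>\<real>\<^sup>n\<close> are functions \<open>nat \<Rightarrow> real\<close> whose entries are those with index in \<open>{1..n}\<close>.\<close>

definition signal :: "real \<Rightarrow> nat set \<Rightarrow> nat \<Rightarrow> real" where
  "signal \<mu> S i = (if i \<in> S then \<mu> else 0)"

definition x_min :: "nat \<Rightarrow> (nat \<Rightarrow> real) \<Rightarrow> real" where
  "x_min n x = Min {\<bar>x i\<bar> |i. i \<in> {1..n} \<and> x i \<noteq> 0}"

lemma x_min_signal:
  assumes "S \<subseteq> {1..n}" "S \<noteq> {}" "\<mu> > 0"
  shows "x_min n (signal \<mu> S) = \<mu>"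
proof -
  obtain j where "j \<in> S" "j \<in> {1..n}" using assms by blast
  then have "{\<bar>signal \<mu> S i\<bar> |i. i \<in> {1..n} \<and> signal \<mu> S i \<noteq> 0} = {\<mu>}"
    using assms by (auto simp: signal_def intro!: exI[of _ j])
  then show ?thesis by (simp add: x_min_def)
qed

definition symmetric_class :: "nat \<Rightarrow> nat \<Rightarrow> nat set set \<Rightarrow> bool" where
  "symmetric_class n s \<C> \<longleftrightarrow>
     \<C> \<noteq> {} \<and> (\<forall>S\<in>\<C>. S \<subseteq> {1..n} \<and> card S = s) \<and>
     (\<forall>i\<in>\<Union>\<C>. measure_pmf.prob (pmf_of_set \<C>) {S. i \<in> S} = real s / real (card (\<Union>\<C>)))"

text \<open>A query is a pair \<open>(A\<^sub>k, \<Gamma>\<^sub>k)\<close>, an observation a triple \<open>(Y\<^sub>k, A\<^sub>k, \<Gamma>\<^sub>k)\<close>. Time starts at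
  \<open>k = 0\<close>, so that the past of step \<open>k\<close> consists of the steps \<open>i < k\<close>.\<close>

definition query_space :: "nat \<Rightarrow> (nat \<times> real) measure" where
  "query_space n = count_space {1..n} \<Otimes>\<^sub>M borel"

definition data_space :: "nat \<Rightarrow> nat set \<Rightarrow> (nat \<Rightarrow> real \<times> nat \<times> real) measure" where
  "data_space n I = (\<Pi>\<^sub>M i\<in>I. borel \<Otimes>\<^sub>M query_space n)"

definition data ::
  "(nat \<Rightarrow> 'w \<Rightarrow> real) \<Rightarrow> (nat \<Rightarrow> 'w \<Rightarrow> nat) \<Rightarrow> (nat \<Rightarrow> 'w \<Rightarrow> real) \<Rightarrow> nat set \<Rightarrow>
   'w \<Rightarrow> nat \<Rightarrow> real \<times> nat \<times> real" where
  "data Y A \<Gamma> I \<omega> = (\<lambda>i\<in>I. (Y i \<omega>, A i \<omega>, \<Gamma> i \<omega>))"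

text \<open>The kernel \<open>\<kappa>\<close> is a (regular) conditional distribution of the random variable \<open>Q\<close> given
  the random variable \<open>H\<close>.\<close>

definition cond_distribution ::
  "'w measure \<Rightarrow> 'h measure \<Rightarrow> ('w \<Rightarrow> 'h) \<Rightarrow> 'q measure \<Rightarrow> ('w \<Rightarrow> 'q) \<Rightarrow> ('h \<Rightarrow> 'q measure) \<Rightarrow> bool" where
  "cond_distribution M MH H MQ Q \<kappa> \<longleftrightarrow>
     H \<in> M \<rightarrow>\<^sub>M MH \<and> Q \<in> M \<rightarrow>\<^sub>M MQ \<and> \<kappa> \<in> MH \<rightarrow>\<^sub>M prob_algebra MQ \<and>
     (\<forall>B\<in>sets MQ. AE \<omega> in M.
        real_cond_exp M (vimage_algebra (space M) H MH) (indicator (Q -` B \<inter> space M)) \<omega>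
          = measure (\<kappa> (H \<omega>)) B)"

text \<open>The strategy \<open>\<A>\<close> assigns to each \<open>k\<close> the conditional distribution of \<open>(A\<^sub>k, \<Gamma>\<^sub>k)\<close> given the
  past. A step with \<open>\<Gamma>\<^sub>k = 0\<close> yields the uninformative value \<open>Y\<^sub>k = 0\<close>; the case distinction is
  needed because \<open>inverse 0 = 0\<close> would otherwise reveal the entry without noise. The budget is a
  sum in \<open>ennreal\<close>, so that its convergence is part of the constraint.\<close>

locale adaptive_sensing = prob_space M
  for M :: "'w measure" +
  fixes n :: nat and m :: real and x :: "nat \<Rightarrow> real"
    and \<A> :: "nat \<Rightarrow> (nat \<Rightarrow> real \<times> nat \<times> real) \<Rightarrow> (nat \<times> real) measure"
    and Y :: "nat \<Rightarrow> 'w \<Rightarrow> real" and A :: "nat \<Rightarrow> 'w \<Rightarrow> nat"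
    and \<Gamma> :: "nat \<Rightarrow> 'w \<Rightarrow> real" and W :: "nat \<Rightarrow> 'w \<Rightarrow> real"
  assumes entry_measurable: "\<And>k. A k \<in> M \<rightarrow>\<^sub>M count_space {1..n}"
    and precision_measurable: "\<And>k. \<Gamma> k \<in> borel_measurable M"
    and query_distribution: "\<And>k. cond_distribution M
          (data_space n {..<k}) (data Y A \<Gamma> {..<k})
          (query_space n) (\<lambda>\<omega>. (A k \<omega>, \<Gamma> k \<omega>)) (\<A> k)"
    and noise_normal: "\<And>k. distributed M lborel (W k) std_normal_density"
    and noise_indep: "\<And>k. indep_set
          (sets (vimage_algebra (space M) (W k) borel))
          (sets (vimage_algebra (space M) (\<lambda>\<omega>. (data Y A \<Gamma> {..<k} \<omega>, (A k \<omega>, \<Gamma> k \<omega>)))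
             (data_space n {..<k} \<Otimes>\<^sub>M query_space n)))"
    and observation: "\<And>k \<omega>. \<omega> \<in> space M \<Longrightarrow>
          Y k \<omega> = (if \<Gamma> k \<omega> = 0 then 0 else x (A k \<omega>) + inverse (\<Gamma> k \<omega>) * W k \<omega>)"
    and budget: "AE \<omega> in M. (\<Sum>k. ennreal ((\<Gamma> k \<omega>)\<^sup>2)) \<le> ennreal m"

definition data_law ::
  "nat \<Rightarrow> 'w measure \<Rightarrow> (nat \<Rightarrow> 'w \<Rightarrow> real) \<Rightarrow> (nat \<Rightarrow> 'w \<Rightarrow> nat) \<Rightarrow> (nat \<Rightarrow> 'w \<Rightarrow> real) \<Rightarrow>
   (nat \<Rightarrow> real \<times> nat \<times> real) measure" where
  "data_law n M Y A \<Gamma> = distr M (data_space n UNIV) (data Y A \<Gamma> UNIV)"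

definition risk ::
  "nat set set \<Rightarrow> (nat set \<Rightarrow> 'd measure) \<Rightarrow> ('d \<Rightarrow> nat) \<Rightarrow> real" where
  "risk \<C> P \<Phi> =
     measure (P {}) {d \<in> space (P {}). \<Phi> d \<noteq> 0} +
     (MAX S\<in>\<C>. measure (P S) {d \<in> space (P S). \<Phi> d \<noteq> 1})"

end

theory Submission imports Defs begin

text \<open>Under \<open>S\<close> the law of the first \<open>k\<close> observations has an explicit density with respect to their
  law under \<open>{}\<close>: the strategy contributes the same conditional distributions under both hypotheses, so
  only the Gaussian factors remain. The mean of the log-density under \<open>{}\<close> is minus half the expected
  precision spent on \<open>S\<close> times \<open>\<mu>\<^sup>2\<close>; averaged over a symmetric class this is at least
  \<open>- \<mu>\<^sup>2 * s * m / (2 * \<bar>\<Xi>\<bar>)\<close>. A Bretagnolle--Huber bound for the uniform mixture of the alternatives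
  then bounds the risk of every test based on \<open>k\<close> observations from below, uniformly in \<open>k\<close>, and an arbitrary
  test is approximated by such tests.\<close>

subsection \<open>Approximation by an algebra\<close>

text \<open>The data under different supports live on unrelated probability spaces; what links them
  is the common kernels \<open>\<A> k\<close>, so hypotheses can be compared only through laws of
  histories. Log-ratios are averaged under the null on purpose. There the queries have one law for
  all supports, so the sum over \<open>\<C>\<close> moves inside the expectation and an entry is
  weighted by the fraction of supports containing it, at most
  \<open>s / card (\<Union>\<C>)\<close>. Under an alternative the queries depend on the support,
  since an adaptive strategy may home in on it, and this exchange breaks down. Only the average
  divergence is controlled, because a strategy may neglect or favour single supports; hence the
  maximum in the risk is first weakened to an average. The horizon stays finite because the
  likelihood ratio of the whole sequence is an infinite product whose convergence would need an
  argument of its own. The partial sums of the precisions are all at most \<open>m\<close>, so the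
  constant does not deteriorate with the horizon.\<close>

lemma sigma_sets_approx_algebra:
  assumes G: "algebra \<Omega> G" and I: "finite I"
    and P: "\<And>i. i \<in> I \<Longrightarrow> finite_measure (P i) \<and> space (P i) = \<Omega> \<and> sets (P i) = sigma_sets \<Omega> G"
    and B: "B \<in> sigma_sets \<Omega> G" and e: "e > 0"
  shows "\<exists>C\<in>G. \<forall>i\<in>I. measure (P i) (sym_diff B C) < e"
proof -
  interpret G: algebra \<Omega> G by fact
  have meas: "X \<in> sets (P i)" if "X \<in> sigma_sets \<Omega> G" "i \<in> I" for X i
    using P that by blast
  show ?thesis
    using B e
  proof (induction arbitrary: e)
    case (Basic a)
    then show ?case by (intro bexI[of _ a]) auto
  next
    case Empty
    then show ?case by (intro bexI[of _ "{}"]) auto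
  next
    case (Compl a)
    then obtain C where C: "C \<in> G" "\<forall>i\<in>I. measure (P i) (sym_diff a C) < e" by blast
    have "a \<subseteq> \<Omega>" "C \<subseteq> \<Omega>"
      using Compl.hyps C(1) G.space_closed sigma_sets_into_sp by blast+
    then have "sym_diff (\<Omega> - a) (\<Omega> - C) = sym_diff a C" by blast
    then show ?case using C by (intro bexI[of _ "\<Omega> - C"]) auto
  next
    case (Union a)
    have "\<forall>\<^sub>F N in sequentially. measure (P i) (\<Union>j. a j) - measure (P i) (\<Union>j<N. a j) < e / 2" if i: "i \<in> I" for i
    proof -
      interpret finite_measure "P i" using P i by blast
      have "(\<lambda>N. measure (P i) (\<Union>j<N. a j)) \<longlonglongrightarrow> measure (P i) (\<Union>N. \<Union>j<N. a j)"
        by (intro finite_Lim_measure_incseq incseq_SucI)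
           (auto simp: less_Suc_eq intro!: meas[OF Union.hyps i])
      moreover have "(\<Union>N. \<Union>j<N. a j) = (\<Union>j. a j)" by auto
      ultimately have "(\<lambda>N. measure (P i) (\<Union>j. a j) - measure (P i) (\<Union>j<N. a j)) \<longlonglongrightarrow> 0"
        by (auto intro!: tendsto_eq_intros)
      then show ?thesis using Union.prems by (intro order_tendstoD) auto
    qed
    then have "\<forall>\<^sub>F N in sequentially. \<forall>i\<in>I. measure (P i) (\<Union>j. a j) - measure (P i) (\<Union>j<N. a j) < e / 2"
      using I by (simp add: eventually_ball_finite)
    \<comment> \<open>Finiteness of \<open>I\<close> is what yields one truncation point for all
      measures at once.\<close>
    then obtain N where N: "\<And>i. i \<in> I \<Longrightarrow> measure (P i) (\<Union>j. a j) - measure (P i) (\<Union>j<N. a j) < e / 2"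
      by (auto simp: eventually_sequentially)
    \<comment> \<open>\<open>Suc N\<close> keeps the tolerance positive for \<open>N = 0\<close>.
      The \<open>N\<close> errors add up to at most \<open>e / 2\<close>, and the strict inequality
      comes from the truncation.\<close>
    have "\<forall>j. \<exists>C\<in>G. \<forall>i\<in>I. measure (P i) (sym_diff (a j) C) < e / (2 * real (Suc N))"
      using Union.prems by (intro allI Union.IH) auto
    then obtain C where C: "\<And>j. C j \<in> G"
      "\<And>i j. i \<in> I \<Longrightarrow> measure (P i) (sym_diff (a j) (C j)) < e / (2 * real (Suc N))"
      by metis
    show ?case
    proof (intro bexI[of _ "\<Union>j<N. C j"] ballI)
      show "(\<Union>j<N. C j) \<in> G" using C by (intro G.finite_UN) auto
      fix i assume i: "i \<in> I"
      interpret finite_measure "P i" using P i by blast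
      have am[measurable]: "a j \<in> sets (P i)" for j using meas[OF Union.hyps i] .
      have Cm[measurable]: "C j \<in> sets (P i)" for j using C(1) i by (intro meas) auto
      have "measure (P i) (sym_diff (\<Union>j. a j) (\<Union>j<N. C j))
        \<le> measure (P i) (((\<Union>j. a j) - (\<Union>j<N. a j)) \<union> (\<Union>j<N. sym_diff (a j) (C j)))"
        by (intro finite_measure_mono) (blast, measurable)
      also have "\<dots> \<le> measure (P i) ((\<Union>j. a j) - (\<Union>j<N. a j)) + measure (P i) (\<Union>j<N. sym_diff (a j) (C j))"
        by (intro measure_Un_le) measurable
      also have "measure (P i) ((\<Union>j. a j) - (\<Union>j<N. a j)) = measure (P i) (\<Union>j. a j) - measure (P i) (\<Union>j<N. a j)"
        by (intro finite_measure_Diff) auto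
      also have "measure (P i) (\<Union>j<N. sym_diff (a j) (C j)) \<le> (\<Sum>j<N. measure (P i) (sym_diff (a j) (C j)))"
        by (intro measure_UNION_le) auto
      also have "\<dots> \<le> (\<Sum>j<N. e / (2 * real (Suc N)))"
        using C(2)[OF i] by (intro sum_mono less_imp_le) auto
      also have "\<dots> \<le> e / 2" using Union.prems by (simp add: field_simps)
      finally show "measure (P i) (sym_diff (\<Union>j. a j) (\<Union>j<N. C j)) < e" using N[OF i] by linarith
    qed
  qed
qed

subsection \<open>The Bretagnolle--Huber bound for mixtures\<close>

text \<open>AM-GM for likelihood ratios: it reduces the density of the mixture to the mean of the
  log-ratios, the quantity whose expectation can be computed.\<close>

lemma exp_avg_le:
  fixes l :: "'c \<Rightarrow> real"
  assumes "finite C" "C \<noteq> {}"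
  shows "exp ((\<Sum>c\<in>C. l c) / card C) \<le> (\<Sum>c\<in>C. exp (l c)) / card C"
proof -
  have "exp (\<Sum>c\<in>C. (1 / card C) *\<^sub>R l c) \<le> (\<Sum>c\<in>C. (1 / card C) * exp (l c))"
    using assms by (intro convex_on_sum[OF _ _ exp_convex]) auto
  then show ?thesis by (simp add: sum_divide_distrib)
qed

text \<open>Here \<open>- (\<integral>\<omega>. l c \<omega> \<partial>M)\<close> is the
  Kullback--Leibler divergence of the null from alternative \<open>c\<close>, so \<open>K\<close>
  bounds the average divergence. Let f be 1 on \<open>B\<close> and the mixture density L off
  \<open>B\<close>, and g the other way round. Then f * g = L, the mean of f is the sum of the two
  errors, and f + g has mean 2. A weighted AM-GM inequality for f and g replaces Cauchy--Schwarz, so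
  the estimate is pointwise and is integrated only once.\<close>

lemma (in prob_space) bretagnolle_huber_mixture:
  fixes l :: "'c \<Rightarrow> 'a \<Rightarrow> real"
  assumes C: "finite C" "C \<noteq> {}"
    and l: "\<And>c. c \<in> C \<Longrightarrow> integrable M (l c)"
    and el: "\<And>c. c \<in> C \<Longrightarrow> integrable M (\<lambda>\<omega>. exp (l c \<omega>))"
    and one: "\<And>c. c \<in> C \<Longrightarrow> (\<integral>\<omega>. exp (l c \<omega>) \<partial>M) = 1"
    and K: "- K \<le> (\<Sum>c\<in>C. (\<integral>\<omega>. l c \<omega> \<partial>M)) / card C"
    and B[measurable]: "B \<in> events"
  shows "exp (- K) / 2 \<le> prob B + (\<Sum>c\<in>C. \<integral>\<omega>. exp (l c \<omega>) * indicator (space M - B) \<omega> \<partial>M) / card C"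
proof -
  \<comment> \<open>\<open>t\<close> weights the error probabilities against the total mass \<open>2\<close> in AM-GM so that the latter uses up
    half of the lower bound \<open>exp (- K / 2)\<close> for the expectation of the geometric mean \<open>exp (v / 2)\<close>.\<close>
  define L where "L \<omega> = (\<Sum>c\<in>C. exp (l c \<omega>)) / card C" for \<omega>
  define v where "v \<omega> = (\<Sum>c\<in>C. l c \<omega>) / card C" for \<omega>
  define t where "t = 2 * exp (K / 2)"
  have t: "t > 0" by (simp add: t_def)
  have Li: "integrable M L" unfolding L_def using el by auto
  have vi: "integrable M v" unfolding v_def using l by auto
  have Lone: "(\<integral>\<omega>. L \<omega> \<partial>M) = 1"
    unfolding L_def using el one C by (simp add: Bochner_Integration.integral_sum)
  have Lii: "integrable M (\<lambda>\<omega>. L \<omega> * indicator (space M - B) \<omega>)"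
    using Li by (intro integrable_real_mult_indicator) auto
  have bint: "(\<integral>\<omega>. L \<omega> * indicator (space M - B) \<omega> \<partial>M)
      = (\<Sum>c\<in>C. \<integral>\<omega>. exp (l c \<omega>) * indicator (space M - B) \<omega> \<partial>M) / card C" (is "_ = ?b")
    unfolding L_def using el
    by (simp add: sum_distrib_right Bochner_Integration.integral_sum integrable_real_mult_indicator)
  have Lpos: "L \<omega> \<ge> 0" for \<omega> unfolding L_def by (simp add: sum_nonneg)
  have amgm: "exp (v \<omega> / 2) \<le> (a * p + q / a) / 2" if "a > 0" "p * q = L \<omega>" "p \<ge> 0" "q \<ge> 0" for a p q \<omega>
  proof -
    have "exp (v \<omega> / 2) ^ 2 = exp (v \<omega>)" by (simp flip: exp_double)
    also have "\<dots> \<le> L \<omega>" unfolding v_def L_def using C by (rule exp_avg_le)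
    also have "\<dots> = (a * p) * (q / a)" using that by simp
    also have "\<dots> \<le> ((a * p + q / a) / 2)\<^sup>2"
    proof -
      have "u * w \<le> ((u + w) / 2)\<^sup>2" for u w :: real
        using sum_squares_bound[of u w] by (simp add: power_divide power2_sum)
      then show ?thesis .
    qed
    finally show ?thesis
      by (rule power2_le_imp_le) (use that(1,3,4) in simp)
  qed
  have pw: "exp (- K / 2) * (1 + v \<omega> / 2 + K / 2)
      \<le> (t * (indicator B \<omega> + L \<omega> * indicator (space M - B) \<omega>) +
         (indicator (space M - B) \<omega> + (L \<omega> - L \<omega> * indicator (space M - B) \<omega>)) / t) / 2"
    if "\<omega> \<in> space M" for \<omega>
  proof -
    \<comment> \<open>The tangent of \<open>exp\<close> at \<open>- K / 2\<close> stands in for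
      Jensen's inequality; since \<open>v\<close> has mean at least \<open>- K\<close>, the tangent
      has mean at least \<open>exp (- K / 2)\<close>.\<close>
    have "exp (- K / 2) * (1 + (v \<omega> / 2 + K / 2)) \<le> exp (- K / 2) * exp (v \<omega> / 2 + K / 2)"
      by (intro mult_left_mono exp_ge_add_one_self) auto
    also have "\<dots> = exp (v \<omega> / 2)" by (simp flip: exp_add)
    also have "\<dots> \<le> (t * (indicator B \<omega> + L \<omega> * indicator (space M - B) \<omega>) +
         (indicator (space M - B) \<omega> + (L \<omega> - L \<omega> * indicator (space M - B) \<omega>)) / t) / 2"
      using amgm[OF t, of 1 "L \<omega>" \<omega>] amgm[OF t, of "L \<omega>" 1 \<omega>] Lpos[of \<omega>] that
      by (auto simp: indicator_def)
    finally show ?thesis by (simp add: add.assoc)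
  qed
  have "exp (- K / 2) \<le> exp (- K / 2) * (1 + (\<integral>\<omega>. v \<omega> \<partial>M) / 2 + K / 2)"
    using K l unfolding v_def by (simp add: Bochner_Integration.integral_sum)
  also have "\<dots> = (\<integral>\<omega>. exp (- K / 2) * (1 + v \<omega> / 2 + K / 2) \<partial>M)"
    using vi by (simp add: prob_space)
  also have "\<dots> \<le> (\<integral>\<omega>. (t * (indicator B \<omega> + L \<omega> * indicator (space M - B) \<omega>) +
         (indicator (space M - B) \<omega> + (L \<omega> - L \<omega> * indicator (space M - B) \<omega>)) / t) / 2 \<partial>M)"
    using vi Li Lii by (intro integral_mono pw) (auto simp: less_top[symmetric])
  also have "\<dots> = (t * (prob B + ?b) + ((1 - prob B) + (1 - ?b)) / t) / 2"
    using vi Li Lii by (simp add: Lone bint prob_compl less_top[symmetric])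
  also have "\<dots> \<le> (t * (prob B + ?b) + 2 / t) / 2"
  proof -
    have "?b \<ge> 0" by (intro divide_nonneg_nonneg sum_nonneg integral_nonneg_AE) auto
    then have "((1 - prob B) + (1 - ?b)) / t \<le> 2 / t"
      using t measure_nonneg[of M B] by (intro divide_right_mono) linarith+
    then have "t * (prob B + ?b) + ((1 - prob B) + (1 - ?b)) / t \<le> t * (prob B + ?b) + 2 / t"
      by (rule add_left_mono)
    then show ?thesis by (rule divide_right_mono) simp
  qed
  finally have "exp (- K / 2) \<le> exp (K / 2) * (prob B + ?b) + exp (- K / 2) / 2"
    by (simp add: t_def exp_minus field_simps)
  then have "exp (- K / 2) / 2 \<le> exp (K / 2) * (prob B + ?b)" by linarith
  then have "exp (- K / 2) * (exp (- K / 2) / 2) \<le> exp (- K / 2) * (exp (K / 2) * (prob B + ?b))"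
    by (intro mult_left_mono) auto
  then show ?thesis by (simp flip: exp_add mult.assoc)
qed

subsection \<open>Likelihood ratios\<close>

text \<open>Separates the noise from the query, so that the noise can be integrated out while the
  query is held fixed.\<close>

definition obs :: "(nat \<Rightarrow> real) \<Rightarrow> nat \<times> real \<Rightarrow> real \<Rightarrow> real" where
  "obs x q w = (if snd q = 0 then 0 else x (fst q) + inverse (snd q) * w)"

text \<open>For \<open>g = 0\<close> the formula gives \<open>0\<close>, as it should: both hypotheses then yield the observation \<open>0\<close>.\<close>

definition log_lr :: "(nat \<Rightarrow> real) \<Rightarrow> real \<times> nat \<times> real \<Rightarrow> real" where
  "log_lr x = (\<lambda>(y, a, g). g\<^sup>2 * x a * y - (g * x a)\<^sup>2 / 2)"

text \<open>Translating the noise by \<open>g * x a\<close> moves the signal out of the observation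
  and into a Gaussian density ratio. Under the null \<open>w = g * y\<close>, which is why
  \<open>log_lr\<close> can be written in terms of the observed triple alone.\<close>

lemma nn_integral_obs:
  assumes f[measurable]: "f \<in> borel_measurable borel"
  shows "(\<integral>\<^sup>+w. f (obs x q w) * ennreal (std_normal_density w) \<partial>lborel)
    = (\<integral>\<^sup>+w. f (obs (\<lambda>_. 0) q w) * ennreal (exp (log_lr x (obs (\<lambda>_. 0) q w, q))) * ennreal (std_normal_density w) \<partial>lborel)"
proof (cases "snd q = 0")
  case True
  then show ?thesis by (simp add: obs_def log_lr_def split_beta)
next
  case False
  obtain a g where q: "q = (a, g)" by (cases q)
  have g: "g \<noteq> 0" using False q by simp
  have "(\<integral>\<^sup>+w. f (x a + inverse g * w) * ennreal (std_normal_density w) \<partial>lborel)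
    = (\<integral>\<^sup>+w. f (x a + inverse g * (- (g * x a) + 1 * w)) * ennreal (std_normal_density (- (g * x a) + 1 * w)) \<partial>lborel)"
    by (subst nn_integral_real_affine[of _ 1 "- (g * x a)"]) auto
  also have "\<dots> = (\<integral>\<^sup>+w. f (inverse g * w) * ennreal (exp (g\<^sup>2 * x a * (inverse g * w) - (g * x a)\<^sup>2 / 2) * std_normal_density w) \<partial>lborel)"
  proof (intro nn_integral_cong)
    fix w
    have "exp (g\<^sup>2 * x a * (inverse g * w) - (g * x a)\<^sup>2 / 2) * exp (- w\<^sup>2 / 2) = exp (- (w - g * x a)\<^sup>2 / 2)"
      using g by (simp add: power2_eq_square field_simps flip: exp_add)
    then have "std_normal_density (- (g * x a) + w)
        = exp (g\<^sup>2 * x a * (inverse g * w) - (g * x a)\<^sup>2 / 2) * std_normal_density w"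
      by (simp add: normal_density_def)
    moreover have "x a + inverse g * (- (g * x a) + w) = inverse g * w"
      using g by (simp add: field_simps)
    ultimately show "f (x a + inverse g * (- (g * x a) + 1 * w)) * ennreal (std_normal_density (- (g * x a) + 1 * w))
      = f (inverse g * w) * ennreal (exp (g\<^sup>2 * x a * (inverse g * w) - (g * x a)\<^sup>2 / 2) * std_normal_density w)"
      by simp
  qed
  finally show ?thesis using g
    by (simp add: obs_def log_lr_def q ennreal_mult mult.assoc)
qed

lemma measurable_entry_query: "(\<lambda>q. x (fst q) :: real) \<in> borel_measurable (query_space n)"
  unfolding query_space_def by (rule measurable_compose[OF measurable_fst]) simp

lemma measurable_precision_query: "snd \<in> borel_measurable (query_space n)"
  unfolding query_space_def by (rule measurable_snd)

lemma measurable_log_lr[measurable]: "log_lr x \<in> borel_measurable (borel \<Otimes>\<^sub>M query_space n)"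
  unfolding log_lr_def split_beta
  by (intro borel_measurable_diff borel_measurable_times borel_measurable_power borel_measurable_divide
      measurable_compose[OF measurable_snd measurable_entry_query]
      measurable_compose[OF measurable_snd measurable_precision_query]) auto

lemma measurable_obs[measurable]:
  "(\<lambda>(q, w). obs x q w) \<in> borel_measurable (query_space n \<Otimes>\<^sub>M borel)"
proof -
  note [measurable] = measurable_compose[OF measurable_fst measurable_precision_query[of n]]
    measurable_compose[OF measurable_fst measurable_entry_query[of x n]]
  show ?thesis unfolding obs_def split_beta by measurable
qed

lemma emeasure_distr_density:
  assumes [measurable]: "f \<in> M \<rightarrow>\<^sub>M N" "g \<in> borel_measurable M" "A \<in> sets N"
  shows "emeasure (distr (density M g) N f) A = (\<integral>\<^sup>+\<omega>. g \<omega> * indicator A (f \<omega>) \<partial>M)"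
proof -
  have "emeasure (distr (density M g) N f) A = (\<integral>\<^sup>+\<omega>. g \<omega> * indicator (f -` A \<inter> space M) \<omega> \<partial>M)"
    by (simp add: emeasure_distr emeasure_density)
  also have "\<dots> = (\<integral>\<^sup>+\<omega>. g \<omega> * indicator A (f \<omega>) \<partial>M)"
    by (intro nn_integral_cong) (simp add: indicator_def)
  finally show ?thesis .
qed

section \<open>Integrating out the noise and the query of a single step\<close>

context adaptive_sensing
begin

abbreviation query :: "nat \<Rightarrow> 'w \<Rightarrow> nat \<times> real" where
  "query k \<omega> \<equiv> (A k \<omega>, \<Gamma> k \<omega>)"

abbreviation history :: "nat \<Rightarrow> 'w \<Rightarrow> nat \<Rightarrow> real \<times> nat \<times> real" where
  "history k \<equiv> data Y A \<Gamma> {..<k}"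

lemma measurable_query[measurable]: "query k \<in> M \<rightarrow>\<^sub>M query_space n"
  using query_distribution[of k] by (simp add: cond_distribution_def)

lemma measurable_history[measurable]: "history k \<in> M \<rightarrow>\<^sub>M data_space n {..<k}"
  using query_distribution[of k] by (simp add: cond_distribution_def)

lemma measurable_noise[measurable]: "W k \<in> borel_measurable M"
  using distributed_measurable[OF noise_normal[of k]] by simp

lemma obs_eq: "\<omega> \<in> space M \<Longrightarrow> Y k \<omega> = obs x (query k \<omega>) (W k \<omega>)"
  by (simp add: observation obs_def)

lemma measurable_observation[measurable]: "Y k \<in> borel_measurable M"
proof -
  have "(\<lambda>\<omega>. obs x (query k \<omega>) (W k \<omega>)) \<in> borel_measurable M"
    using measurable_compose[OF _ measurable_obs[of x n], of "\<lambda>\<omega>. (query k \<omega>, W k \<omega>)"] by simp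
  then show ?thesis by (subst measurable_cong[OF obs_eq])
qed

lemma measurable_data[measurable]: "data Y A \<Gamma> I \<in> M \<rightarrow>\<^sub>M data_space n I"
  unfolding data_def data_space_def by (intro measurable_restrict) measurable

lemma indep_query_noise:
  "indep_set (sigma_sets (space M) {W k -` B \<inter> space M | B. B \<in> sets borel})
    (sigma_sets (space M) {(\<lambda>\<omega>. (history k \<omega>, query k \<omega>)) -` B \<inter> space M | B.
       B \<in> sets (data_space n {..<k} \<Otimes>\<^sub>M query_space n)})"
  using noise_indep[of k] unfolding sets_vimage_algebra .

lemma distr_history_noise:
  "distr M (data_space n {..<k} \<Otimes>\<^sub>M query_space n) (\<lambda>\<omega>. (history k \<omega>, query k \<omega>))
     \<Otimes>\<^sub>M distr M borel (W k)
   = distr M ((data_space n {..<k} \<Otimes>\<^sub>M query_space n) \<Otimes>\<^sub>M borel)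
      (\<lambda>\<omega>. ((history k \<omega>, query k \<omega>), W k \<omega>))"
proof -
  let ?X = "\<lambda>\<omega>. (history k \<omega>, query k \<omega>)"
  let ?S = "data_space n {..<k} \<Otimes>\<^sub>M query_space n"
  interpret X: prob_space "distr M ?S ?X" by (rule prob_space_distr) measurable
  interpret W: prob_space "distr M borel (W k)" by (rule prob_space_distr) measurable
  show ?thesis
  proof (rule pair_measure_eqI)
    fix A B assume "A \<in> sets (distr M ?S ?X)" "B \<in> sets (distr M borel (W k))"
    then have [measurable]: "A \<in> sets ?S" "B \<in> sets borel" by auto
    have "prob ((W k -` B \<inter> space M) \<inter> (?X -` A \<inter> space M)) = prob (W k -` B \<inter> space M) * prob (?X -` A \<inter> space M)"
      by (intro indep_setD[OF indep_query_noise[of k]] sigma_sets.Basic) auto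
    moreover have "(W k -` B \<inter> space M) \<inter> (?X -` A \<inter> space M) = (\<lambda>\<omega>. (?X \<omega>, W k \<omega>)) -` (A \<times> B) \<inter> space M"
      by auto
    ultimately show "emeasure (distr M ?S ?X) A * emeasure (distr M borel (W k)) B
        = emeasure (distr M (?S \<Otimes>\<^sub>M borel) (\<lambda>\<omega>. (?X \<omega>, W k \<omega>))) (A \<times> B)"
      by (simp add: emeasure_distr emeasure_eq_measure ennreal_mult'' mult.commute)
  qed (auto intro: X.sigma_finite_measure_axioms W.sigma_finite_measure_axioms cong: sets_pair_measure_cong)
qed

text \<open>Independence makes the joint law of past, query and noise a product; Fubini then treats
  an adaptive step as one with past and query frozen.\<close>

lemma nn_integral_noise:
  assumes f[measurable]: "f \<in> borel_measurable ((data_space n {..<k} \<Otimes>\<^sub>M query_space n) \<Otimes>\<^sub>M borel)"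
  shows "(\<integral>\<^sup>+\<omega>. f ((history k \<omega>, query k \<omega>), W k \<omega>) \<partial>M)
    = (\<integral>\<^sup>+\<omega>. \<integral>\<^sup>+w. f ((history k \<omega>, query k \<omega>), w) * ennreal (std_normal_density w) \<partial>lborel \<partial>M)"
proof -
  let ?X = "\<lambda>\<omega>. (history k \<omega>, query k \<omega>)"
  let ?S = "data_space n {..<k} \<Otimes>\<^sub>M query_space n"
  have D: "distr M borel (W k) = density lborel std_normal_density"
    using distributed_distr_eq_density[OF noise_normal[of k]] by (simp cong: distr_cong)
  interpret N: prob_space "density lborel (\<lambda>w. ennreal (std_normal_density w))"
    using prob_space_distr[of "W k" borel] unfolding D by simp
  have "(\<integral>\<^sup>+\<omega>. f (?X \<omega>, W k \<omega>) \<partial>M) = (\<integral>\<^sup>+z. f z \<partial>distr M (?S \<Otimes>\<^sub>M borel) (\<lambda>\<omega>. (?X \<omega>, W k \<omega>)))"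
    by (subst nn_integral_distr) auto
  also have "\<dots> = (\<integral>\<^sup>+z. f z \<partial>(distr M ?S ?X \<Otimes>\<^sub>M density lborel std_normal_density))"
    by (simp add: distr_history_noise flip: D)
  also have "\<dots> = (\<integral>\<^sup>+h. \<integral>\<^sup>+w. f (h, w) \<partial>density lborel std_normal_density \<partial>distr M ?S ?X)"
    by (subst N.nn_integral_fst[symmetric]) auto
  also have "\<dots> = (\<integral>\<^sup>+h. \<integral>\<^sup>+w. f (h, w) * ennreal (std_normal_density w) \<partial>lborel \<partial>distr M ?S ?X)"
    by (intro nn_integral_cong) (subst nn_integral_density, auto simp: mult.commute)
  also have "\<dots> = (\<integral>\<^sup>+\<omega>. \<integral>\<^sup>+w. f (?X \<omega>, w) * ennreal (std_normal_density w) \<partial>lborel \<partial>M)"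
    by (subst nn_integral_distr) auto
  finally show ?thesis .
qed

text \<open>Weighting \<open>M\<close> by the indicator of the query and by the kernel gives the
  same measure on histories: on events of the history this is the defining property of conditional
  expectation. Comparing measures instead of integrals covers unbounded \<open>u\<close>, which will
  later contain a likelihood ratio.\<close>

lemma nn_integral_query:
  assumes u[measurable]: "u \<in> borel_measurable (data_space n {..<k})" and B[measurable]: "B \<in> sets (query_space n)"
  shows "(\<integral>\<^sup>+\<omega>. u (history k \<omega>) * indicator B (query k \<omega>) \<partial>M)
    = (\<integral>\<^sup>+\<omega>. u (history k \<omega>) * ennreal (measure (\<A> k (history k \<omega>)) B) \<partial>M)"
proof -
  let ?H = "data_space n {..<k}" and ?q = "\<lambda>\<omega>. measure (\<A> k (history k \<omega>)) B"
  let ?F = "vimage_algebra (space M) (history k) ?H" and ?Q = "query k -` B \<inter> space M"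
  have cd: "AE \<omega> in M. real_cond_exp M ?F (indicator ?Q) \<omega> = ?q \<omega>"
    and \<A>[measurable]: "\<A> k \<in> ?H \<rightarrow>\<^sub>M prob_algebra (query_space n)"
    using query_distribution[of k] B by (auto simp: cond_distribution_def)
  have [measurable]: "(\<lambda>h. measure (\<A> k h) B) \<in> borel_measurable ?H"
    using \<A> B by (intro measurable_compose[OF measurable_prob_algebraD[OF \<A>] measurable_measure_subprob_algebra])
  have sub: "subalgebra M ?F"
    unfolding subalgebra_def by (auto simp: sets_vimage_algebra2 measurable_space[OF measurable_history])
  interpret F: finite_measure_subalgebra M ?F by unfold_locales (fact sub)
  have q1: "?q \<omega> \<le> 1" if "\<omega> \<in> space M" for \<omega>
    using measurable_space[OF measurable_compose[OF measurable_history \<A>] that]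
    by (auto simp: space_prob_algebra intro: prob_space.prob_le_1)
  have "distr (density M (\<lambda>\<omega>. indicator B (query k \<omega>))) ?H (history k)
      = distr (density M (\<lambda>\<omega>. ennreal (?q \<omega>))) ?H (history k)"
  proof (intro measure_eqI)
    fix C assume "C \<in> sets (distr (density M (\<lambda>\<omega>. indicator B (query k \<omega>))) ?H (history k))"
    then have C[measurable]: "C \<in> sets ?H" by simp
    let ?C = "history k -` C \<inter> space M"
    have CF: "?C \<in> sets ?F" by (auto simp: sets_vimage_algebra2 measurable_space[OF measurable_history])
    have qi: "integrable M ?q"
      by (intro integrable_const_bound[of _ 1]) (auto intro!: AE_I2 q1)
    have "measure M (?C \<inter> ?Q) = (LINT \<omega>:?C|M. indicator ?Q \<omega>)"
      by (simp add: set_lebesgue_integral_def flip: indicator_inter_arith)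
    also have "\<dots> = (LINT \<omega>:?C|M. real_cond_exp M ?F (indicator ?Q) \<omega>)"
      by (intro F.real_cond_exp_intA CF integrable_const_bound[of _ 1] borel_measurable_indicator
          measurable_sets[OF measurable_query B]) auto
    also have "\<dots> = (LINT \<omega>:?C|M. ?q \<omega>)"
      using cd by (intro set_lebesgue_integral_cong_AE) auto
    finally have eq: "measure M (?C \<inter> ?Q) = (LINT \<omega>:?C|M. ?q \<omega>)" .
    have "emeasure (distr (density M (\<lambda>\<omega>. indicator B (query k \<omega>))) ?H (history k)) C
        = (\<integral>\<^sup>+\<omega>. indicator B (query k \<omega>) * indicator C (history k \<omega>) \<partial>M)"
      by (rule emeasure_distr_density) auto
    also have "\<dots> = (\<integral>\<^sup>+\<omega>. indicator (?C \<inter> ?Q) \<omega> \<partial>M)"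
      by (intro nn_integral_cong) (auto simp: indicator_def)
    also have "\<dots> = emeasure M (?C \<inter> ?Q)"
      by (intro nn_integral_indicator sets.Int measurable_sets[OF measurable_query B] measurable_sets[OF measurable_history C])
    also have "\<dots> = ennreal (LINT \<omega>:?C|M. ?q \<omega>)" by (simp add: emeasure_eq_measure eq)
    also have "\<dots> = (\<integral>\<^sup>+\<omega>. ennreal (indicator ?C \<omega> * ?q \<omega>) \<partial>M)"
      unfolding set_lebesgue_integral_def real_scaleR_def
      by (intro nn_integral_eq_integral[symmetric] integrable_mult_indicator[where 'b=real, unfolded real_scaleR_def] qi) auto
    also have "\<dots> = emeasure (distr (density M (\<lambda>\<omega>. ennreal (?q \<omega>))) ?H (history k)) C"
      by (subst emeasure_distr_density) (auto simp: indicator_def intro!: nn_integral_cong)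
    finally show "emeasure (distr (density M (\<lambda>\<omega>. indicator B (query k \<omega>))) ?H (history k)) C
      = emeasure (distr (density M (\<lambda>\<omega>. ennreal (?q \<omega>))) ?H (history k)) C" .
  qed simp
  then have "(\<integral>\<^sup>+h. u h \<partial>distr (density M (\<lambda>\<omega>. indicator B (query k \<omega>))) ?H (history k))
      = (\<integral>\<^sup>+h. u h \<partial>distr (density M (\<lambda>\<omega>. ennreal (?q \<omega>))) ?H (history k))" by simp
  then show ?thesis
    by (simp add: nn_integral_distr nn_integral_density mult.commute)
qed

end

section \<open>Change of measure from an alternative to the null\<close>

lemma measurable_kernel:
  assumes "adaptive_sensing M n m x \<A> Y A \<Gamma> W" "B \<in> sets (query_space n)"
  shows "(\<lambda>h. measure (\<A> k h) B) \<in> borel_measurable (data_space n {..<k})"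
proof -
  interpret adaptive_sensing M n m x \<A> Y A \<Gamma> W by fact
  have "\<A> k \<in> data_space n {..<k} \<rightarrow>\<^sub>M prob_algebra (query_space n)"
    using query_distribution[of k] by (auto simp: cond_distribution_def)
  then show ?thesis
    using assms(2)
    by (intro measurable_compose[OF measurable_prob_algebraD measurable_measure_subprob_algebra])
qed

text \<open>This is where the strategy's ignorance of the support enters. Both processes draw the
  query from the same kernel, so a density \<open>L\<close> for the histories remains the density
  once the query is adjoined. The kernel probability of a fixed set is a function of the history, so
  \<open>transfer\<close> applies to it; rectangles suffice because they form a generator stable
  under intersection.\<close>

lemma nn_integral_transfer_query:
  assumes sensing1: "adaptive_sensing M1 n m x1 \<A> Y1 A1 \<Gamma>1 W1"
    and sensing0: "adaptive_sensing M0 n m x0 \<A> Y0 A0 \<Gamma>0 W0"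
    and L[measurable]: "L \<in> borel_measurable (data_space n {..<k})"
    and transfer: "\<And>u. u \<in> borel_measurable (data_space n {..<k}) \<Longrightarrow>
      (\<integral>\<^sup>+\<omega>. u (data Y1 A1 \<Gamma>1 {..<k} \<omega>) \<partial>M1)
        = (\<integral>\<^sup>+\<omega>. u (data Y0 A0 \<Gamma>0 {..<k} \<omega>) * L (data Y0 A0 \<Gamma>0 {..<k} \<omega>) \<partial>M0)"
    and u[measurable]: "u \<in> borel_measurable (data_space n {..<k} \<Otimes>\<^sub>M query_space n)"
  shows "(\<integral>\<^sup>+\<omega>. u (data Y1 A1 \<Gamma>1 {..<k} \<omega>, (A1 k \<omega>, \<Gamma>1 k \<omega>)) \<partial>M1)
    = (\<integral>\<^sup>+\<omega>. u (data Y0 A0 \<Gamma>0 {..<k} \<omega>, (A0 k \<omega>, \<Gamma>0 k \<omega>)) * L (data Y0 A0 \<Gamma>0 {..<k} \<omega>) \<partial>M0)"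
proof -
  interpret M1: adaptive_sensing M1 n m x1 \<A> Y1 A1 \<Gamma>1 W1 by fact
  interpret M0: adaptive_sensing M0 n m x0 \<A> Y0 A0 \<Gamma>0 W0 by fact
  let ?H = "data_space n {..<k}" and ?Q = "query_space n"
  let ?X1 = "\<lambda>\<omega>. (M1.history k \<omega>, M1.query k \<omega>)" and ?X0 = "\<lambda>\<omega>. (M0.history k \<omega>, M0.query k \<omega>)"
  let ?N1 = "distr M1 (?H \<Otimes>\<^sub>M ?Q) ?X1"
  let ?N0 = "distr (density M0 (\<lambda>\<omega>. L (M0.history k \<omega>))) (?H \<Otimes>\<^sub>M ?Q) ?X0"
  have "?N1 = ?N0"
  proof (rule measure_eqI_generator_eq[OF Int_stable_pair_measure_generator[of ?H ?Q], where \<Omega> = "space ?H \<times> space ?Q"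
        and A = "\<lambda>_. space ?H \<times> space ?Q"])
    show "{a \<times> b |a b. a \<in> sets ?H \<and> b \<in> sets ?Q} \<subseteq> Pow (space ?H \<times> space ?Q)"
      by (rule pair_measure_closed)
    show "sets ?N1 = sigma_sets (space ?H \<times> space ?Q) {a \<times> b |a b. a \<in> sets ?H \<and> b \<in> sets ?Q}"
      "sets ?N0 = sigma_sets (space ?H \<times> space ?Q) {a \<times> b |a b. a \<in> sets ?H \<and> b \<in> sets ?Q}"
      by (simp_all add: sets_pair_measure)
    show "range (\<lambda>_. space ?H \<times> space ?Q) \<subseteq> {a \<times> b |a b. a \<in> sets ?H \<and> b \<in> sets ?Q}"
      "(\<Union>i::nat. space ?H \<times> space ?Q) = space ?H \<times> space ?Q" by auto
    interpret N1: prob_space ?N1 by (rule M1.prob_space_distr) measurable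
    show "emeasure ?N1 (space ?H \<times> space ?Q) \<noteq> \<infinity>" by simp
    fix X assume "X \<in> {a \<times> b |a b. a \<in> sets ?H \<and> b \<in> sets ?Q}"
    then obtain a b where X: "X = a \<times> b" and [measurable]: "a \<in> sets ?H" and b[measurable]: "b \<in> sets ?Q" by auto
    note [measurable] = measurable_kernel[OF sensing1 b, of k]
    have "emeasure ?N1 X = (\<integral>\<^sup>+\<omega>. indicator a (M1.history k \<omega>) * indicator b (M1.query k \<omega>) \<partial>M1)"
      unfolding X by (subst nn_integral_indicator[symmetric], simp, subst nn_integral_distr)
        (auto simp: indicator_def intro!: nn_integral_cong)
    also have "\<dots> = (\<integral>\<^sup>+\<omega>. indicator a (M1.history k \<omega>) * ennreal (measure (\<A> k (M1.history k \<omega>)) b) \<partial>M1)"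
      by (rule M1.nn_integral_query) auto
    also have "\<dots> = (\<integral>\<^sup>+\<omega>. (indicator a (M0.history k \<omega>) * L (M0.history k \<omega>)) * ennreal (measure (\<A> k (M0.history k \<omega>)) b) \<partial>M0)"
      by (subst transfer) (auto simp: mult_ac)
    also have "\<dots> = (\<integral>\<^sup>+\<omega>. (indicator a (M0.history k \<omega>) * L (M0.history k \<omega>)) * indicator b (M0.query k \<omega>) \<partial>M0)"
      by (rule M0.nn_integral_query[symmetric]) auto
    also have "\<dots> = emeasure ?N0 X"
      unfolding X by (subst emeasure_distr_density) (auto simp: indicator_def intro!: nn_integral_cong)
    finally show "emeasure ?N1 X = emeasure ?N0 X" .
  qed
  then have "(\<integral>\<^sup>+z. u z \<partial>?N1) = (\<integral>\<^sup>+z. u z \<partial>?N0)" by simp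
  then show ?thesis by (simp add: nn_integral_distr nn_integral_density mult.commute)
qed

lemma measurable_sum_log_lr[measurable]:
  "(\<lambda>h. \<Sum>i<k. log_lr x (h i)) \<in> borel_measurable (data_space n {..<k})"
  unfolding data_space_def
  by (rule borel_measurable_sum, rule measurable_compose[OF _ measurable_log_lr[of x n]],
      rule measurable_component_singleton)

lemma data_Suc: "data Y A \<Gamma> {..<Suc k} \<omega> = (data Y A \<Gamma> {..<k} \<omega>)(k := (Y k \<omega>, A k \<omega>, \<Gamma> k \<omega>))"
  by (auto simp: data_def fun_eq_iff)

text \<open>Induction on the horizon. The last step is peeled off from the inside out: its noise is
  averaged and shifted to the null, then the past with the query is transferred by the induction
  hypothesis, and finally the null noise is put back.\<close>

lemma nn_integral_data_lr:
  assumes sensing1: "adaptive_sensing M1 n m x \<A> Y1 A1 \<Gamma>1 W1"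
    and sensing0: "adaptive_sensing M0 n m (\<lambda>_. 0) \<A> Y0 A0 \<Gamma>0 W0"
    and f: "f \<in> borel_measurable (data_space n {..<k})"
  shows "(\<integral>\<^sup>+\<omega>. f (data Y1 A1 \<Gamma>1 {..<k} \<omega>) \<partial>M1)
    = (\<integral>\<^sup>+\<omega>. f (data Y0 A0 \<Gamma>0 {..<k} \<omega>) * ennreal (exp (\<Sum>i<k. log_lr x (data Y0 A0 \<Gamma>0 {..<k} \<omega> i))) \<partial>M0)"
proof -
  interpret M1: adaptive_sensing M1 n m x \<A> Y1 A1 \<Gamma>1 W1 by fact
  interpret M0: adaptive_sensing M0 n m "\<lambda>_. 0" \<A> Y0 A0 \<Gamma>0 W0 by fact
  show ?thesis
    using f
  proof (induction k arbitrary: f)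
    case 0
    \<comment> \<open>The empty history is the everywhere undefined function in both processes, and
      the empty sum gives density 1.\<close>
    have "data Y1 A1 \<Gamma>1 {..<0} \<omega> = (\<lambda>_. undefined)" "data Y0 A0 \<Gamma>0 {..<0} \<omega>' = (\<lambda>_. undefined)" for \<omega> \<omega>'
      by (auto simp: data_def fun_eq_iff)
    then show ?case by (simp add: M1.emeasure_space_1 M0.emeasure_space_1)
  next
    case (Suc k)
    note [measurable] = Suc.prems
    let ?H = "data_space n {..<k}" and ?Q = "query_space n"
    let ?L = "\<lambda>h. ennreal (exp (\<Sum>i<k. log_lr x (h i)))"
    \<comment> \<open>\<open>z\<close> is the past together with the current query; \<open>F\<close>
      appends the observation \<open>y\<close> as step \<open>k\<close>.\<close>
    define F where "F z y = f ((fst z)(k := (y, snd z)))" for z y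
    have upd[measurable]: "(\<lambda>(z, y). F z y) \<in> borel_measurable ((?H \<Otimes>\<^sub>M ?Q) \<Otimes>\<^sub>M borel)"
      unfolding F_def split_beta
      by (rule measurable_compose[OF _ Suc.prems], unfold data_space_def, rule measurable_fun_upd[where J = "{..<k}"])
         (auto simp flip: data_space_def)
    define R where "R z = (\<lambda>y. F z y * ennreal (exp (log_lr x (y, snd z))))" for z
    have obs_meas[measurable]: "(\<lambda>(z, w). obs x' (snd z) w) \<in> borel_measurable ((?H \<Otimes>\<^sub>M ?Q) \<Otimes>\<^sub>M borel)" for x'
      using measurable_compose[OF _ measurable_obs[of x' n], of "\<lambda>(z, w). (snd z, w)" "(?H \<Otimes>\<^sub>M ?Q) \<Otimes>\<^sub>M borel"]
      by (simp add: split_beta)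
    have R[measurable]: "(\<lambda>(z, y). R z y) \<in> borel_measurable ((?H \<Otimes>\<^sub>M ?Q) \<Otimes>\<^sub>M borel)"
      unfolding R_def split_beta
      using upd measurable_compose[OF _ measurable_log_lr[of x n], of "\<lambda>p. (snd p, snd (fst p))" "(?H \<Otimes>\<^sub>M ?Q) \<Otimes>\<^sub>M borel"]
      by (simp add: split_beta)
    have F_obs[measurable]: "(\<lambda>p. F (fst p) (obs x' (snd (fst p)) (snd p))) \<in> borel_measurable ((?H \<Otimes>\<^sub>M ?Q) \<Otimes>\<^sub>M borel)" for x'
      using measurable_compose[OF _ upd, of "\<lambda>p. (fst p, obs x' (snd (fst p)) (snd p))" "(?H \<Otimes>\<^sub>M ?Q) \<Otimes>\<^sub>M borel"]
        obs_meas[of x'] by (simp add: split_beta)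
    have R_obs[measurable]: "(\<lambda>p. R (fst p) (obs x' (snd (fst p)) (snd p))) \<in> borel_measurable ((?H \<Otimes>\<^sub>M ?Q) \<Otimes>\<^sub>M borel)" for x'
      using measurable_compose[OF _ R, of "\<lambda>p. (fst p, obs x' (snd (fst p)) (snd p))" "(?H \<Otimes>\<^sub>M ?Q) \<Otimes>\<^sub>M borel"]
        obs_meas[of x'] by (simp add: split_beta)
    \<comment> \<open>\<open>U\<close> already carries the likelihood factor of step
      \<open>k\<close>, so it is one and the same function of past and query for both
      processes.\<close>
    define U where "U z = (\<integral>\<^sup>+w. R z (obs (\<lambda>_. 0) (snd z) w) * ennreal (std_normal_density w) \<partial>lborel)" for z
    have U[measurable]: "U \<in> borel_measurable (?H \<Otimes>\<^sub>M ?Q)"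
    proof -
      have "(\<lambda>(z, w). R z (obs (\<lambda>_. 0) (snd z) w) * ennreal (std_normal_density w)) \<in> borel_measurable ((?H \<Otimes>\<^sub>M ?Q) \<Otimes>\<^sub>M lborel)"
        using R_obs[of "\<lambda>_. 0"] by (simp add: split_beta)
      then show ?thesis unfolding U_def by (rule lborel.borel_measurable_nn_integral)
    qed
    have "(\<integral>\<^sup>+\<omega>. f (data Y1 A1 \<Gamma>1 {..<Suc k} \<omega>) \<partial>M1)
      = (\<integral>\<^sup>+\<omega>. F (M1.history k \<omega>, M1.query k \<omega>) (obs x (M1.query k \<omega>) (W1 k \<omega>)) \<partial>M1)"
      by (intro nn_integral_cong) (simp only: data_Suc F_def fst_conv snd_conv M1.obs_eq[symmetric])
    also have "\<dots> = (\<integral>\<^sup>+\<omega>. \<integral>\<^sup>+w. F (M1.history k \<omega>, M1.query k \<omega>) (obs x (M1.query k \<omega>) w) * ennreal (std_normal_density w) \<partial>lborel \<partial>M1)"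
      using M1.nn_integral_noise[OF F_obs[of x]] by simp
    also have "\<dots> = (\<integral>\<^sup>+\<omega>. U (M1.history k \<omega>, M1.query k \<omega>) \<partial>M1)"
    proof (intro nn_integral_cong)
      fix \<omega> assume "\<omega> \<in> space M1"
      then have "(M1.history k \<omega>, M1.query k \<omega>) \<in> space (?H \<Otimes>\<^sub>M ?Q)"
        by (rule measurable_space[of "\<lambda>\<omega>. (M1.history k \<omega>, M1.query k \<omega>)", rotated]) measurable
      then have "F (M1.history k \<omega>, M1.query k \<omega>) \<in> borel_measurable borel"
        using measurable_Pair2[OF upd] by simp
      from nn_integral_obs[OF this, of x "M1.query k \<omega>"]
      show "(\<integral>\<^sup>+w. F (M1.history k \<omega>, M1.query k \<omega>) (obs x (M1.query k \<omega>) w) * ennreal (std_normal_density w) \<partial>lborel)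
        = U (M1.history k \<omega>, M1.query k \<omega>)"
        by (simp add: U_def R_def)
    qed
    also have "\<dots> = (\<integral>\<^sup>+\<omega>. U (M0.history k \<omega>, M0.query k \<omega>) * ?L (M0.history k \<omega>) \<partial>M0)"
      by (rule nn_integral_transfer_query[OF sensing1 sensing0 _ Suc.IH]) auto
    also have "\<dots> = (\<integral>\<^sup>+\<omega>. \<integral>\<^sup>+w. R (M0.history k \<omega>, M0.query k \<omega>) (obs (\<lambda>_. 0) (M0.query k \<omega>) w) * ?L (M0.history k \<omega>) * ennreal (std_normal_density w) \<partial>lborel \<partial>M0)"
    proof (intro nn_integral_cong)
      fix \<omega> assume "\<omega> \<in> space M0"
      then have "(M0.history k \<omega>, M0.query k \<omega>) \<in> space (?H \<Otimes>\<^sub>M ?Q)"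
        by (rule measurable_space[of "\<lambda>\<omega>. (M0.history k \<omega>, M0.query k \<omega>)", rotated]) measurable
      from measurable_Pair2[OF R_obs[of "\<lambda>_. 0"] this]
      have "(\<lambda>w. R (M0.history k \<omega>, M0.query k \<omega>) (obs (\<lambda>_. 0) (M0.query k \<omega>) w)) \<in> borel_measurable borel"
        by simp
      then show "U (M0.history k \<omega>, M0.query k \<omega>) * ?L (M0.history k \<omega>)
        = (\<integral>\<^sup>+w. R (M0.history k \<omega>, M0.query k \<omega>) (obs (\<lambda>_. 0) (M0.query k \<omega>) w) * ?L (M0.history k \<omega>) * ennreal (std_normal_density w) \<partial>lborel)"
        unfolding U_def by (subst nn_integral_multc[symmetric]) (auto simp: mult_ac)
    qed
    \<comment> \<open>The averaging over the noise is undone, now under the null.\<close>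
    also have "\<dots> = (\<integral>\<^sup>+\<omega>. R (M0.history k \<omega>, M0.query k \<omega>) (obs (\<lambda>_. 0) (M0.query k \<omega>) (W0 k \<omega>)) * ?L (M0.history k \<omega>) \<partial>M0)"
      using M0.nn_integral_noise[of "\<lambda>p. R (fst p) (obs (\<lambda>_. 0) (snd (fst p)) (snd p)) * ?L (fst (fst p))" k] by simp
    also have "\<dots> = (\<integral>\<^sup>+\<omega>. f (data Y0 A0 \<Gamma>0 {..<Suc k} \<omega>) * ennreal (exp (\<Sum>i<Suc k. log_lr x (data Y0 A0 \<Gamma>0 {..<Suc k} \<omega> i))) \<partial>M0)"
      by (intro nn_integral_cong)
         (simp add: data_Suc F_def R_def M0.obs_eq[symmetric] exp_add ennreal_mult mult_ac)
    finally show ?case .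
  qed
qed

subsection \<open>Expected log-likelihood ratios\<close>

context adaptive_sensing
begin

lemma AE_sum_precision_le:
  assumes "0 \<le> m"
  shows "AE \<omega> in M. (\<Sum>i<k. (\<Gamma> i \<omega>)\<^sup>2) \<le> m"
  using budget
proof eventually_elim
  case (elim \<omega>)
  have "ennreal (\<Sum>i<k. (\<Gamma> i \<omega>)\<^sup>2) = (\<Sum>i<k. ennreal ((\<Gamma> i \<omega>)\<^sup>2))" by simp
  also have "\<dots> \<le> (\<Sum>i. ennreal ((\<Gamma> i \<omega>)\<^sup>2))" by (rule sum_le_suminf) auto
  also have "\<dots> \<le> ennreal m" by (fact elim)
  finally show ?case using assms by simp
qed

lemma AE_precision_le:
  assumes "0 \<le> m"
  shows "AE \<omega> in M. (\<Gamma> k \<omega>)\<^sup>2 \<le> m"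
  using AE_sum_precision_le[OF assms, of "Suc k"]
proof eventually_elim
  case (elim \<omega>)
  moreover have "0 \<le> (\<Sum>i<k. (\<Gamma> i \<omega>)\<^sup>2)" by (intro sum_nonneg) auto
  ultimately show ?case by simp
qed

lemma measurable_entry[measurable]: "(\<lambda>\<omega>. p (A k \<omega>) :: real) \<in> borel_measurable M"
  by (rule measurable_compose[OF entry_measurable]) simp

lemma measurable_precision[measurable]: "\<Gamma> k \<in> borel_measurable M"
  by (fact precision_measurable)

text \<open>Integrability comes from boundedness: the budget forces each
  \<open>\<bar>\<Gamma> k \<omega>\<bar>\<close> to be at most \<open>sqrt m\<close> almost
  surely.\<close>

lemma integrable_precision:
  fixes p :: "nat \<Rightarrow> real"
  assumes m: "0 \<le> m" and p: "\<And>a. \<bar>p a\<bar> \<le> c"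
  shows "integrable M (\<lambda>\<omega>. \<Gamma> k \<omega> * p (A k \<omega>))"
    and "integrable M (\<lambda>\<omega>. (\<Gamma> k \<omega> * p (A k \<omega>))\<^sup>2)"
proof -
  have c: "0 \<le> c" using p[of 0] by linarith
  have bd: "AE \<omega> in M. \<bar>\<Gamma> k \<omega> * p (A k \<omega>)\<bar> \<le> sqrt m * c"
    using AE_precision_le[OF m, of k]
  proof eventually_elim
    case (elim \<omega>)
    then have "\<bar>\<Gamma> k \<omega>\<bar> \<le> sqrt m" by (intro real_le_rsqrt) simp
    then show ?case unfolding abs_mult using p c m by (intro mult_mono) auto
  qed
  then show "integrable M (\<lambda>\<omega>. \<Gamma> k \<omega> * p (A k \<omega>))"
    by (intro integrable_const_bound[where B = "sqrt m * c"]) auto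
  show "integrable M (\<lambda>\<omega>. (\<Gamma> k \<omega> * p (A k \<omega>))\<^sup>2)"
  proof (intro integrable_const_bound[where B = "(sqrt m * c)\<^sup>2"])
    show "AE \<omega> in M. norm ((\<Gamma> k \<omega> * p (A k \<omega>))\<^sup>2) \<le> (sqrt m * c)\<^sup>2"
      using bd by eventually_elim (use power_mono[OF _ abs_ge_zero, where n = 2] in force)
  qed auto
qed

text \<open>The product is a function of the current query, hence generates a smaller sigma-algebra
  than past and query together. It serves to make the cross term of the log-ratio vanish in the
  mean.\<close>

lemma indep_precision_noise:
  fixes p :: "nat \<Rightarrow> real"
  shows "indep_var borel (W k) borel (\<lambda>\<omega>. \<Gamma> k \<omega> * p (A k \<omega>))"
  unfolding indep_var_eq
proof (intro conjI)
  let ?X = "\<lambda>\<omega>. (history k \<omega>, query k \<omega>)"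
  let ?S = "data_space n {..<k} \<Otimes>\<^sub>M query_space n"
  let ?g = "\<lambda>z. snd (snd z) * p (fst (snd z))"
  note [measurable] = measurable_compose[OF measurable_snd measurable_precision_query[of n]]
    measurable_compose[OF measurable_snd measurable_entry_query[of p n]]
  have g[measurable]: "?g \<in> borel_measurable ?S" by measurable
  have sub: "{(\<lambda>\<omega>. \<Gamma> k \<omega> * p (A k \<omega>)) -` B \<inter> space M |B. B \<in> sets borel}
      \<subseteq> {?X -` B \<inter> space M |B. B \<in> sets ?S}"
  proof safe
    fix B :: "real set" assume "B \<in> sets borel"
    then show "\<exists>B'. (\<lambda>\<omega>. \<Gamma> k \<omega> * p (A k \<omega>)) -` B \<inter> space M = ?X -` B' \<inter> space M \<and> B' \<in> sets ?S"
      using measurable_space[OF measurable_history] measurable_space[OF measurable_query]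
      by (intro exI[of _ "?g -` B \<inter> space ?S"] conjI measurable_sets[OF g])
         (auto simp: space_pair_measure)
  qed
  show "indep_set (sigma_sets (space M) {W k -` B \<inter> space M |B. B \<in> sets borel})
     (sigma_sets (space M) {(\<lambda>\<omega>. \<Gamma> k \<omega> * p (A k \<omega>)) -` B \<inter> space M |B. B \<in> sets borel})"
    using indep_query_noise[of k] unfolding indep_set_def
    by (rule indep_sets_mono_sets) (use sigma_sets_mono'[OF sub] in \<open>auto split: bool.split\<close>)
qed measurable

lemma noise_expectation: "integrable M (W k)" "expectation (W k) = 0"
  using integrable_std_normal_moment[of 1] distributed_integrable[OF noise_normal, of "\<lambda>w. w" k]
    standard_normal_distributed_expectation[OF noise_normal]
  by auto

end

locale null_sensing = adaptive_sensing M n m "\<lambda>_. 0" \<A> Y A \<Gamma> W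
  for M :: "'w measure" and n m \<A> Y A \<Gamma> W
begin

lemma log_lr_eq:
  assumes "\<omega> \<in> space M"
  shows "log_lr x (Y k \<omega>, A k \<omega>, \<Gamma> k \<omega>)
    = W k \<omega> * (\<Gamma> k \<omega> * x (A k \<omega>)) - (\<Gamma> k \<omega> * x (A k \<omega>))\<^sup>2 / 2"
  using assms by (simp add: log_lr_def observation power2_eq_square)

text \<open>With V = \<open>\<Gamma> k \<omega> * x (A k \<omega>)\<close> the null log-ratio is W *
  V - V^2 / 2, and W is centred and independent of V, so only the quadratic part survives.\<close>

lemma expectation_log_lr:
  assumes m: "0 \<le> m" and x: "\<And>a. \<bar>x a\<bar> \<le> c"
  shows "integrable M (\<lambda>\<omega>. log_lr x (Y k \<omega>, A k \<omega>, \<Gamma> k \<omega>))"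
    and "expectation (\<lambda>\<omega>. log_lr x (Y k \<omega>, A k \<omega>, \<Gamma> k \<omega>)) = - expectation (\<lambda>\<omega>. (\<Gamma> k \<omega> * x (A k \<omega>))\<^sup>2) / 2"
proof -
  note i = integrable_precision[where p = x, OF m x]
  note W = indep_var_integrable[OF indep_precision_noise noise_expectation(1) i(1)]
    indep_var_lebesgue_integral[OF indep_precision_noise noise_expectation(1) i(1)]
  show "integrable M (\<lambda>\<omega>. log_lr x (Y k \<omega>, A k \<omega>, \<Gamma> k \<omega>))"
    using W(1) i(2) by (subst Bochner_Integration.integrable_cong[OF refl log_lr_eq]) auto
  show "expectation (\<lambda>\<omega>. log_lr x (Y k \<omega>, A k \<omega>, \<Gamma> k \<omega>)) = - expectation (\<lambda>\<omega>. (\<Gamma> k \<omega> * x (A k \<omega>))\<^sup>2) / 2"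
    using W i(2) by (subst Bochner_Integration.integral_cong[OF refl log_lr_eq]) (auto simp: noise_expectation)
qed

end

section \<open>Risk of tests with a finite horizon\<close>

lemma symmetric_class_inclusion_le:
  assumes "symmetric_class n s \<C>"
  shows "real (card {S\<in>\<C>. i \<in> S}) / card \<C> \<le> real s / card (\<Union>\<C>)"
proof (cases "i \<in> \<Union>\<C>")
  case True
  have "\<C> \<noteq> {}" "\<C> \<subseteq> Pow {1..n}" using assms by (auto simp: symmetric_class_def)
  then have "finite \<C>" "\<C> \<noteq> {}" by (auto intro: finite_subset)
  then have "measure_pmf.prob (pmf_of_set \<C>) {S. i \<in> S} = real (card {S\<in>\<C>. i \<in> S}) / card \<C>"
    by (simp add: measure_pmf_of_set Int_def)
  moreover have "measure_pmf.prob (pmf_of_set \<C>) {S. i \<in> S} = real s / card (\<Union>\<C>)"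
    using assms True unfolding symmetric_class_def by blast
  ultimately show ?thesis by simp
next
  \<comment> \<open>A strategy may also measure entries that lie in no support; these give it
    nothing, and the bound must cover them too.\<close>
  case False
  then have empty: "{S\<in>\<C>. i \<in> S} = {}" by auto
  show ?thesis unfolding empty by simp
qed

lemma data_component: "i < k \<Longrightarrow> data Y A \<Gamma> {..<k} \<omega> i = (Y i \<omega>, A i \<omega>, \<Gamma> i \<omega>)"
  by (simp add: data_def)

text \<open>\<open>B\<close> is the rejection region of a test that sees \<open>k\<close> steps. The
  left-hand side is free of \<open>k\<close>, which allows the horizon to be chosen afterwards,
  depending on the test to be approximated.\<close>

lemma cylinder_risk_lower_bound:
  fixes M :: "nat set \<Rightarrow> 'w measure"
  assumes m: "m > 0"
    and \<C>: "symmetric_class n s \<C>"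
    and sensing: "\<And>S. S \<in> insert {} \<C> \<Longrightarrow>
           adaptive_sensing (M S) n m (signal \<mu> S) \<A> (Y S) (A S) (\<Gamma> S) (W S)"
    and B[measurable]: "B \<in> sets (data_space n {..<k})"
  shows "exp (- (\<mu>\<^sup>2 * s * m / (2 * real (card (\<Union>\<C>))))) / 2
    \<le> measure (M {}) {\<omega> \<in> space (M {}). data (Y {}) (A {}) (\<Gamma> {}) {..<k} \<omega> \<in> B}
      + (\<Sum>S\<in>\<C>. measure (M S) {\<omega> \<in> space (M S). data (Y S) (A S) (\<Gamma> S) {..<k} \<omega> \<notin> B}) / card \<C>"
proof -
  have "\<C> \<noteq> {}" "\<C> \<subseteq> Pow {1..n}" using \<C> by (auto simp: symmetric_class_def)
  then have fin: "finite \<C>" "\<C> \<noteq> {}" by (auto intro: finite_subset)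
  have sig0: "signal \<mu> {} = (\<lambda>_. 0)" by (auto simp: signal_def)
  have sensing0: "adaptive_sensing (M {}) n m (\<lambda>_. 0) \<A> (Y {}) (A {}) (\<Gamma> {}) (W {})"
    using sensing[of "{}"] by (simp add: sig0)
  interpret M0: null_sensing "M {}" n m \<A> "Y {}" "A {}" "\<Gamma> {}" "W {}"
    unfolding null_sensing_def by (fact sensing0)
  let ?H = "data_space n {..<k}"
  define l where "l S \<omega> = (\<Sum>i<k. log_lr (signal \<mu> S) (M0.history k \<omega> i))" for S \<omega>
  have l[measurable]: "l S \<in> borel_measurable (M {})" for S
    unfolding l_def using measurable_compose[OF M0.measurable_history measurable_sum_log_lr] .
  have l_eq: "l S \<omega> = (\<Sum>i<k. log_lr (signal \<mu> S) (Y {} i \<omega>, A {} i \<omega>, \<Gamma> {} i \<omega>))" for S \<omega>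
    unfolding l_def by (intro sum.cong) (auto simp: data_component)
  have sb: "\<bar>signal \<mu> S a\<bar> \<le> \<bar>\<mu>\<bar>" for S a by (simp add: signal_def)
  have m0: "0 \<le> m" using m by simp
  note mom = M0.expectation_log_lr[where x = "signal \<mu> S" for S, OF m0 sb]
    M0.integrable_precision[where p = "signal \<mu> S" for S, OF m0 sb]
  \<comment> \<open>Used twice: with the whole space for \<open>E\<close> it gives total mass one,
    with the complement of \<open>B\<close> the probabilities of missed detection.\<close>
  have lr: "(\<integral>\<omega>. exp (l S \<omega>) * indicator E (M0.history k \<omega>) \<partial>M {})
        = measure (M S) {\<omega> \<in> space (M S). data (Y S) (A S) (\<Gamma> S) {..<k} \<omega> \<in> E}"
      "integrable (M {}) (\<lambda>\<omega>. exp (l S \<omega>) * indicator E (M0.history k \<omega>))"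
    if S: "S \<in> \<C>" and E[measurable]: "E \<in> sets ?H" for S E
  proof -
    interpret MS: adaptive_sensing "M S" n m "signal \<mu> S" \<A> "Y S" "A S" "\<Gamma> S" "W S"
      using S by (intro sensing) auto
    have "emeasure (M S) {\<omega> \<in> space (M S). MS.history k \<omega> \<in> E}
        = (\<integral>\<^sup>+\<omega>. indicator {\<omega> \<in> space (M S). MS.history k \<omega> \<in> E} \<omega> \<partial>M S)"
      by (rule nn_integral_indicator[symmetric]) measurable
    also have "\<dots> = (\<integral>\<^sup>+\<omega>. indicator E (MS.history k \<omega>) \<partial>M S)"
      by (intro nn_integral_cong) (simp add: indicator_def)
    also have "\<dots> = (\<integral>\<^sup>+\<omega>. indicator E (M0.history k \<omega>) * ennreal (exp (l S \<omega>)) \<partial>M {})"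
      unfolding l_def by (rule nn_integral_data_lr[OF MS.adaptive_sensing_axioms sensing0]) simp
    also have "\<dots> = (\<integral>\<^sup>+\<omega>. ennreal (exp (l S \<omega>) * indicator E (M0.history k \<omega>)) \<partial>M {})"
      by (intro nn_integral_cong) (simp add: indicator_def)
    finally have eq: "(\<integral>\<^sup>+\<omega>. ennreal (exp (l S \<omega>) * indicator E (M0.history k \<omega>)) \<partial>M {})
      = ennreal (measure (M S) {\<omega> \<in> space (M S). MS.history k \<omega> \<in> E})"
      by (simp add: MS.emeasure_eq_measure)
    show "integrable (M {}) (\<lambda>\<omega>. exp (l S \<omega>) * indicator E (M0.history k \<omega>))"
      by (rule integrableI_nn_integral_finite[OF _ _ eq]) auto
    show "(\<integral>\<omega>. exp (l S \<omega>) * indicator E (M0.history k \<omega>) \<partial>M {})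
        = measure (M S) {\<omega> \<in> space (M S). MS.history k \<omega> \<in> E}"
      by (subst integral_eq_nn_integral) (auto simp: eq)
  qed
  have sp: "indicator (space ?H) (M0.history k \<omega>) = (1::real)" if "\<omega> \<in> space (M {})" for \<omega>
    using measurable_space[OF M0.measurable_history that] by simp
  let ?\<Xi> = "real (card (\<Union>\<C>))"
  \<comment> \<open>Precision times squared signal, summed over the steps and averaged over the
    supports; half its mean is the average divergence. The average over \<open>S\<close> sits
    inside, next to a query that does not depend on \<open>S\<close>.\<close>
  let ?T = "\<lambda>\<omega>. \<Sum>i<k. (\<Gamma> {} i \<omega>)\<^sup>2 * (\<Sum>S\<in>\<C>. (signal \<mu> S (A {} i \<omega>))\<^sup>2) / card \<C>"
  have avg: "(\<Sum>S\<in>\<C>. (signal \<mu> S a)\<^sup>2) / card \<C> \<le> \<mu>\<^sup>2 * (s / ?\<Xi>)" for a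
  proof -
    have "(\<Sum>S\<in>\<C>. (signal \<mu> S a)\<^sup>2) = (\<Sum>S | S \<in> \<C> \<and> a \<in> S. \<mu>\<^sup>2)"
      using fin by (intro sum.mono_neutral_cong_right) (auto simp: signal_def)
    then have "(\<Sum>S\<in>\<C>. (signal \<mu> S a)\<^sup>2) / card \<C> = \<mu>\<^sup>2 * (real (card {S\<in>\<C>. a \<in> S}) / card \<C>)" by simp
    also have "\<dots> \<le> \<mu>\<^sup>2 * (s / ?\<Xi>)"
      by (intro mult_left_mono symmetric_class_inclusion_le[OF \<C>]) simp
    finally show ?thesis .
  qed
  have T: "integrable (M {}) ?T"
  proof -
    have "?T = (\<lambda>\<omega>. \<Sum>i<k. (\<Sum>S\<in>\<C>. (\<Gamma> {} i \<omega> * signal \<mu> S (A {} i \<omega>))\<^sup>2) / card \<C>)"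
      by (simp add: power_mult_distrib sum_distrib_left)
    then show ?thesis using mom(4) by simp
  qed
  have "M0.expectation ?T \<le> M0.expectation (\<lambda>_. m * (\<mu>\<^sup>2 * (s / ?\<Xi>)))"
  proof (rule integral_mono_AE[OF T])
    show "AE \<omega> in M {}. ?T \<omega> \<le> m * (\<mu>\<^sup>2 * (s / ?\<Xi>))"
      using M0.AE_sum_precision_le[OF m0, of k]
    proof eventually_elim
      case (elim \<omega>)
      have "?T \<omega> \<le> (\<Sum>i<k. (\<Gamma> {} i \<omega>)\<^sup>2 * (\<mu>\<^sup>2 * (s / ?\<Xi>)))"
        unfolding times_divide_eq_right[symmetric] by (intro sum_mono mult_left_mono avg) auto
      also have "\<dots> = (\<Sum>i<k. (\<Gamma> {} i \<omega>)\<^sup>2) * (\<mu>\<^sup>2 * (s / ?\<Xi>))" by (rule sum_distrib_right[symmetric])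
      also have "\<dots> \<le> m * (\<mu>\<^sup>2 * (s / ?\<Xi>))" using elim by (intro mult_right_mono) auto
      finally show ?case .
    qed
  qed simp
  then have Tle: "M0.expectation ?T \<le> m * (\<mu>\<^sup>2 * (s / ?\<Xi>))" by (simp add: M0.prob_space)
  have "(\<Sum>S\<in>\<C>. M0.expectation (l S)) / card \<C> = - M0.expectation ?T / 2"
  proof -
    have "M0.expectation (l S) = (\<Sum>i<k. - M0.expectation (\<lambda>\<omega>. (\<Gamma> {} i \<omega> * signal \<mu> S (A {} i \<omega>))\<^sup>2) / 2)" for S
      unfolding l_eq using mom by (subst Bochner_Integration.integral_sum) auto
    then have "(\<Sum>S\<in>\<C>. M0.expectation (l S)) / card \<C>
      = - ((\<Sum>i<k. \<Sum>S\<in>\<C>. M0.expectation (\<lambda>\<omega>. (\<Gamma> {} i \<omega> * signal \<mu> S (A {} i \<omega>))\<^sup>2)) / card \<C>) / 2"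
      by (subst sum.swap) (simp add: sum_negf sum_divide_distrib mult.commute)
    also have "(\<Sum>i<k. \<Sum>S\<in>\<C>. M0.expectation (\<lambda>\<omega>. (\<Gamma> {} i \<omega> * signal \<mu> S (A {} i \<omega>))\<^sup>2)) / card \<C> = M0.expectation ?T"
      using mom(4) by (simp add: power_mult_distrib sum_distrib_left sum_divide_distrib)
    finally show ?thesis .
  qed
  then have K: "- (\<mu>\<^sup>2 * s * m / (2 * ?\<Xi>)) \<le> (\<Sum>S\<in>\<C>. M0.expectation (l S)) / card \<C>"
    using Tle by (simp add: field_simps)
  let ?B = "M0.history k -` B \<inter> space (M {})"
  have "exp (- (\<mu>\<^sup>2 * s * m / (2 * ?\<Xi>))) / 2
    \<le> M0.prob ?B + (\<Sum>S\<in>\<C>. \<integral>\<omega>. exp (l S \<omega>) * indicator (space (M {}) - ?B) \<omega> \<partial>M {}) / card \<C>"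
  proof (rule M0.bretagnolle_huber_mixture[OF fin _ _ _ K])
    show "integrable (M {}) (l S)" for S unfolding l_eq using mom by auto
    fix S assume S: "S \<in> \<C>"
    interpret MS: adaptive_sensing "M S" n m "signal \<mu> S" \<A> "Y S" "A S" "\<Gamma> S" "W S"
      using S by (intro sensing) auto
    have "{\<omega> \<in> space (M S). MS.history k \<omega> \<in> space ?H} = space (M S)"
      using measurable_space[OF MS.measurable_history] by auto
    then show "integrable (M {}) (\<lambda>\<omega>. exp (l S \<omega>))" "(\<integral>\<omega>. exp (l S \<omega>) \<partial>M {}) = 1"
      using lr[OF S sets.top] by (simp_all add: sp MS.prob_space cong: Bochner_Integration.integrable_cong Bochner_Integration.integral_cong)
  qed simp
  also have "(\<Sum>S\<in>\<C>. \<integral>\<omega>. exp (l S \<omega>) * indicator (space (M {}) - ?B) \<omega> \<partial>M {})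
    = (\<Sum>S\<in>\<C>. measure (M S) {\<omega> \<in> space (M S). data (Y S) (A S) (\<Gamma> S) {..<k} \<omega> \<notin> B})"
  proof (intro sum.cong refl)
    fix S assume S: "S \<in> \<C>"
    interpret MS: adaptive_sensing "M S" n m "signal \<mu> S" \<A> "Y S" "A S" "\<Gamma> S" "W S"
      using S by (intro sensing) auto
    have "(\<integral>\<omega>. exp (l S \<omega>) * indicator (space (M {}) - ?B) \<omega> \<partial>M {})
      = (\<integral>\<omega>. exp (l S \<omega>) * indicator (space ?H - B) (M0.history k \<omega>) \<partial>M {})"
      using measurable_space[OF M0.measurable_history]
      by (intro Bochner_Integration.integral_cong) (auto simp: indicator_def)
    also have "\<dots> = measure (M S) {\<omega> \<in> space (M S). MS.history k \<omega> \<in> space ?H - B}"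
      by (rule lr(1)[OF S]) auto
    also have "{\<omega> \<in> space (M S). MS.history k \<omega> \<in> space ?H - B} = {\<omega> \<in> space (M S). MS.history k \<omega> \<notin> B}"
      using measurable_space[OF MS.measurable_history] by auto
    finally show "(\<integral>\<omega>. exp (l S \<omega>) * indicator (space (M {}) - ?B) \<omega> \<partial>M {})
      = measure (M S) {\<omega> \<in> space (M S). MS.history k \<omega> \<notin> B}" .
  qed
  also have "?B = {\<omega> \<in> space (M {}). M0.history k \<omega> \<in> B}" by auto
  finally show ?thesis .
qed

subsection \<open>Cylinder events\<close>

text \<open>Initial segments are used as index sets because they are totally ordered, so two
  cylinders always share a horizon, and because a cylinder is then a test on the first
  \<open>k\<close> observations.\<close>

definition cylinders :: "nat \<Rightarrow> (nat \<Rightarrow> real \<times> nat \<times> real) set set" where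
  "cylinders n = {(\<lambda>d. restrict d {..<k}) -` B \<inter> space (data_space n UNIV) | k B. B \<in> sets (data_space n {..<k})}"

lemma measurable_restrict_data:
  "J \<subseteq> I \<Longrightarrow> (\<lambda>d. restrict d J) \<in> data_space n I \<rightarrow>\<^sub>M data_space n J"
  unfolding data_space_def by (rule measurable_restrict_subset)

text \<open>Quantifying over all later horizons lets two cylinders be rewritten at the larger of
  their horizons.\<close>

lemma cylinders_extend:
  assumes "X \<in> cylinders n"
  obtains k where "\<And>k'. k \<le> k' \<Longrightarrow>
    \<exists>B\<in>sets (data_space n {..<k'}). X = (\<lambda>d. restrict d {..<k'}) -` B \<inter> space (data_space n UNIV)"
proof -
  obtain k B where B: "B \<in> sets (data_space n {..<k})"
    and X: "X = (\<lambda>d. restrict d {..<k}) -` B \<inter> space (data_space n UNIV)"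
    using assms by (auto simp: cylinders_def)
  show ?thesis
  proof (rule that[of k])
    fix k' assume k: "k \<le> k'"
    let ?B = "(\<lambda>d. restrict d {..<k}) -` B \<inter> space (data_space n {..<k'})"
    have "?B \<in> sets (data_space n {..<k'})"
      using k B by (intro measurable_sets[OF measurable_restrict_data]) auto
    moreover have "restrict (restrict d {..<k'}) {..<k} = restrict d {..<k}" for d :: "nat \<Rightarrow> real \<times> nat \<times> real"
      using k by (auto simp: fun_eq_iff)
    then have "X = (\<lambda>d. restrict d {..<k'}) -` ?B \<inter> space (data_space n UNIV)"
      using measurable_space[OF measurable_restrict_data[of "{..<k'}" UNIV n]] unfolding X by auto
    ultimately show "\<exists>B\<in>sets (data_space n {..<k'}). X = (\<lambda>d. restrict d {..<k'}) -` B \<inter> space (data_space n UNIV)" by blast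
  qed
qed

lemma algebra_cylinders: "algebra (space (data_space n UNIV)) (cylinders n)"
  unfolding algebra_iff_Un
proof (intro conjI ballI)
  let ?\<Omega> = "space (data_space n UNIV)"
  show "cylinders n \<subseteq> Pow ?\<Omega>" by (auto simp: cylinders_def)
  show "{} \<in> cylinders n" unfolding cylinders_def by (auto intro!: exI[of _ "{}"])
  fix a assume a: "a \<in> cylinders n"
  then obtain k B where B: "B \<in> sets (data_space n {..<k})"
    "a = (\<lambda>d. restrict d {..<k}) -` B \<inter> ?\<Omega>" by (auto simp: cylinders_def)
  then have "?\<Omega> - a = (\<lambda>d. restrict d {..<k}) -` (space (data_space n {..<k}) - B) \<inter> ?\<Omega>"
    using measurable_space[OF measurable_restrict_data[of "{..<k}" UNIV n]] by auto
  then show "?\<Omega> - a \<in> cylinders n" using B unfolding cylinders_def by blast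
  fix b assume b: "b \<in> cylinders n"
  obtain k1 where k1: "\<And>k'. k1 \<le> k' \<Longrightarrow> \<exists>B\<in>sets (data_space n {..<k'}). a = (\<lambda>d. restrict d {..<k'}) -` B \<inter> ?\<Omega>"
    using cylinders_extend[OF a] by blast
  obtain k2 where k2: "\<And>k'. k2 \<le> k' \<Longrightarrow> \<exists>B\<in>sets (data_space n {..<k'}). b = (\<lambda>d. restrict d {..<k'}) -` B \<inter> ?\<Omega>"
    using cylinders_extend[OF b] by blast
  let ?k = "max k1 k2"
  obtain B1 B2 where "B1 \<in> sets (data_space n {..<?k})" "B2 \<in> sets (data_space n {..<?k})"
    "a = (\<lambda>d. restrict d {..<?k}) -` B1 \<inter> ?\<Omega>" "b = (\<lambda>d. restrict d {..<?k}) -` B2 \<inter> ?\<Omega>"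
    using k1[of ?k] k2[of ?k] by auto
  then have "a \<union> b = (\<lambda>d. restrict d {..<?k}) -` (B1 \<union> B2) \<inter> ?\<Omega>" "B1 \<union> B2 \<in> sets (data_space n {..<?k})" by auto
  then show "a \<union> b \<in> cylinders n" unfolding cylinders_def by blast
qed

lemma sets_data_space_cylinders:
  "sets (data_space n UNIV) = sigma_sets (space (data_space n UNIV)) (cylinders n)"
proof
  let ?\<Omega> = "space (data_space n UNIV)" and ?T = "borel \<Otimes>\<^sub>M query_space n"
  have \<Omega>: "?\<Omega> = (\<Pi>\<^sub>E i\<in>UNIV. space ?T)" by (simp add: data_space_def space_PiM)
  show "sigma_sets ?\<Omega> (cylinders n) \<subseteq> sets (data_space n UNIV)"
    by (intro sets.sigma_sets_subset)
       (auto simp: cylinders_def intro!: measurable_sets[OF measurable_restrict_data])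
  have "sets (data_space n UNIV) = sigma_sets ?\<Omega> {{f\<in>?\<Omega>. f i \<in> E} | i E. i \<in> UNIV \<and> E \<in> sets ?T}"
    unfolding \<Omega> by (simp add: data_space_def sets_PiM_single)
  also have "\<dots> \<subseteq> sigma_sets ?\<Omega> (cylinders n)"
  proof (intro sigma_sets_mono', safe)
    fix i :: nat and E :: "(real \<times> nat \<times> real) set"
    assume E: "E \<in> sets ?T"
    \<comment> \<open>\<open>Suc i\<close> is the shortest horizon that contains coordinate
      \<open>i\<close>.\<close>
    let ?B = "(\<lambda>f. f i) -` E \<inter> space (data_space n {..<Suc i})"
    have "(\<lambda>f. f i) \<in> data_space n {..<Suc i} \<rightarrow>\<^sub>M ?T"
      unfolding data_space_def by (rule measurable_component_singleton) simp
    then have "?B \<in> sets (data_space n {..<Suc i})" using E by (rule measurable_sets)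
    moreover have "{f\<in>?\<Omega>. f i \<in> E} = (\<lambda>d. restrict d {..<Suc i}) -` ?B \<inter> ?\<Omega>"
      using measurable_space[OF measurable_restrict_data[of "{..<Suc i}" UNIV n]] by auto
    ultimately show "{f\<in>?\<Omega>. f i \<in> E} \<in> cylinders n" unfolding cylinders_def by blast
  qed
  finally show "sets (data_space n UNIV) \<subseteq> sigma_sets ?\<Omega> (cylinders n)" .
qed

section \<open>From cylinder tests to arbitrary tests\<close>

lemma (in adaptive_sensing) prob_space_data_law: "prob_space (data_law n M Y A \<Gamma>)"
  unfolding data_law_def by (rule prob_space_distr) measurable

lemma (in adaptive_sensing) measure_data_law_cylinder:
  assumes "B \<in> sets (data_space n {..<k})"
  shows "measure (data_law n M Y A \<Gamma>) ((\<lambda>d. restrict d {..<k}) -` B \<inter> space (data_space n UNIV))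
    = prob {\<omega> \<in> space M. data Y A \<Gamma> {..<k} \<omega> \<in> B}"
proof -
  have r: "restrict (data Y A \<Gamma> UNIV \<omega>) {..<k} = data Y A \<Gamma> {..<k} \<omega>" for \<omega>
    by (auto simp: data_def fun_eq_iff)
  show ?thesis
    unfolding data_law_def
    using measurable_space[OF measurable_data[of UNIV]]
    by (subst measure_distr) (auto simp: r assms intro!: measurable_sets[OF measurable_restrict_data] arg_cong[where f = prob])
qed

lemma data_law_simps [simp]:
  "space (data_law n M Y A \<Gamma>) = space (data_space n UNIV)"
  "sets (data_law n M Y A \<Gamma>) = sets (data_space n UNIV)"
  by (simp_all add: data_law_def)

lemma (in finite_measure) measure_le_sym_diff:
  assumes "B \<in> sets M" "C \<in> sets M"
  shows "measure M C \<le> measure M B + measure M (sym_diff B C)"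
proof -
  have "measure M C \<le> measure M (B \<union> sym_diff B C)"
    using assms by (intro finite_measure_mono) auto
  also have "\<dots> \<le> measure M B + measure M (sym_diff B C)"
    using assms by (intro measure_Un_le) auto
  finally show ?thesis .
qed

text \<open>Replacing the rejection region by a cylinder costs at most \<open>e / 2\<close> under
  the null and at most \<open>e / 2\<close> in the averaged missed detections, for arbitrary
  \<open>e > 0\<close>.\<close>

lemma risk_lower_bound:
  fixes M :: "nat set \<Rightarrow> 'w measure"
  assumes m: "m > 0"
    and \<C>: "symmetric_class n s \<C>"
    and sensing: "\<And>S. S \<in> insert {} \<C> \<Longrightarrow>
           adaptive_sensing (M S) n m (signal \<mu> S) \<A> (Y S) (A S) (\<Gamma> S) (W S)"
    and \<Phi>: "\<Phi> \<in> data_space n UNIV \<rightarrow>\<^sub>M count_space {0, 1}"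
  shows "exp (- (\<mu>\<^sup>2 * s * m / (2 * real (card (\<Union>\<C>))))) / 2
    \<le> risk \<C> (\<lambda>S. data_law n (M S) (Y S) (A S) (\<Gamma> S)) \<Phi>"
proof (rule field_le_epsilon)
  fix e :: real assume e: "e > 0"
  have "\<C> \<noteq> {}" "\<C> \<subseteq> Pow {1..n}" using \<C> by (auto simp: symmetric_class_def)
  then have fin: "finite \<C>" "\<C> \<noteq> {}" by (auto intro: finite_subset)
  let ?P = "\<lambda>S. data_law n (M S) (Y S) (A S) (\<Gamma> S)" and ?\<Omega> = "space (data_space n UNIV)"
  let ?D = "{d \<in> ?\<Omega>. \<Phi> d \<noteq> 0}"
  have P: "prob_space (?P S)" if "S \<in> insert {} \<C>" for S
    by (rule adaptive_sensing.prob_space_data_law[OF sensing[OF that]])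
  have D: "?D \<in> sets (data_space n UNIV)"
  proof -
    have "\<Phi> -` {1} \<inter> ?\<Omega> \<in> sets (data_space n UNIV)" by (intro measurable_sets[OF \<Phi>]) auto
    moreover have "\<Phi> -` {1} \<inter> ?\<Omega> = ?D" using measurable_space[OF \<Phi>] by force
    ultimately show ?thesis by simp
  qed
  have Dc: "{d \<in> ?\<Omega>. \<Phi> d \<noteq> 1} = ?\<Omega> - ?D" using measurable_space[OF \<Phi>] by force
  \<comment> \<open>A single cylinder has to work under the null and all alternatives
    simultaneously; this is possible because \<open>\<C>\<close> is finite.\<close>
  have "\<exists>X\<in>cylinders n. \<forall>S\<in>insert {} \<C>. measure (?P S) (sym_diff ?D X) < e / 2"
  proof (rule sigma_sets_approx_algebra[OF algebra_cylinders])
    show "?D \<in> sigma_sets ?\<Omega> (cylinders n)" using D by (simp add: sets_data_space_cylinders)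
    show "finite_measure (?P S) \<and> space (?P S) = ?\<Omega> \<and> sets (?P S) = sigma_sets ?\<Omega> (cylinders n)"
      if "S \<in> insert {} \<C>" for S
      using P[OF that] by (simp add: sets_data_space_cylinders prob_space_def)
  qed (use fin e in auto)
  then obtain X where X: "X \<in> cylinders n"
    and close: "\<And>S. S \<in> insert {} \<C> \<Longrightarrow> measure (?P S) (sym_diff ?D X) < e / 2" by blast
  obtain k B where B: "B \<in> sets (data_space n {..<k})"
    and XB: "X = (\<lambda>d. restrict d {..<k}) -` B \<inter> ?\<Omega>" using X by (auto simp: cylinders_def)
  have Xs: "X \<in> sets (data_space n UNIV)"
    using X by (simp add: sets_data_space_cylinders sigma_sets.Basic)
  have "measure (?P {}) X \<le> measure (?P {}) ?D + e / 2"
  proof -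
    interpret prob_space "?P {}" using P by simp
    show ?thesis using measure_le_sym_diff[of ?D X] close[of "{}"] D Xs by simp
  qed
  moreover have "measure (?P S) (?\<Omega> - X) \<le> Max ((\<lambda>S. measure (?P S) (?\<Omega> - ?D)) ` \<C>) + e / 2" if S: "S \<in> \<C>" for S
  proof -
    interpret prob_space "?P S" using P S by simp
    have "sym_diff (?\<Omega> - ?D) (?\<Omega> - X) = sym_diff ?D X"
      using sets.sets_into_space[OF Xs] by auto
    then have "measure (?P S) (?\<Omega> - X) \<le> measure (?P S) (?\<Omega> - ?D) + e / 2"
      using measure_le_sym_diff[of "?\<Omega> - ?D" "?\<Omega> - X"] close[of S] D Xs S by simp
    moreover have "measure (?P S) (?\<Omega> - ?D) \<le> Max ((\<lambda>S. measure (?P S) (?\<Omega> - ?D)) ` \<C>)"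
      using fin S by (intro Max_ge) auto
    ultimately show ?thesis by simp
  qed
  \<comment> \<open>The maximum dominates every term and therefore the average.\<close>
  then have "(\<Sum>S\<in>\<C>. measure (?P S) (?\<Omega> - X))
      \<le> of_nat (card \<C>) * (Max ((\<lambda>S. measure (?P S) (?\<Omega> - ?D)) ` \<C>) + e / 2)"
    by (rule sum_bounded_above)
  then have "(\<Sum>S\<in>\<C>. measure (?P S) (?\<Omega> - X)) / card \<C> \<le> Max ((\<lambda>S. measure (?P S) (?\<Omega> - ?D)) ` \<C>) + e / 2"
    using fin by (simp add: divide_le_eq card_gt_0_iff mult.commute)
  moreover have "exp (- (\<mu>\<^sup>2 * s * m / (2 * real (card (\<Union>\<C>))))) / 2
      \<le> measure (?P {}) X + (\<Sum>S\<in>\<C>. measure (?P S) (?\<Omega> - X)) / card \<C>"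
  proof -
    have "measure (?P {}) X = measure (M {}) {\<omega> \<in> space (M {}). data (Y {}) (A {}) (\<Gamma> {}) {..<k} \<omega> \<in> B}"
      unfolding XB by (rule adaptive_sensing.measure_data_law_cylinder[OF sensing B]) simp
    moreover have "measure (?P S) (?\<Omega> - X) = measure (M S) {\<omega> \<in> space (M S). data (Y S) (A S) (\<Gamma> S) {..<k} \<omega> \<notin> B}"
      if S: "S \<in> \<C>" for S
    proof -
      interpret MS: adaptive_sensing "M S" n m "signal \<mu> S" \<A> "Y S" "A S" "\<Gamma> S" "W S"
        using S by (intro sensing) auto
      have "?\<Omega> - X = (\<lambda>d. restrict d {..<k}) -` (space (data_space n {..<k}) - B) \<inter> ?\<Omega>"
        using measurable_space[OF measurable_restrict_data[of "{..<k}" UNIV n]] unfolding XB by auto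
      moreover have "{\<omega> \<in> space (M S). MS.history k \<omega> \<in> space (data_space n {..<k}) - B}
        = {\<omega> \<in> space (M S). MS.history k \<omega> \<notin> B}"
        using measurable_space[OF MS.measurable_history] by auto
      ultimately show ?thesis
        using MS.measure_data_law_cylinder[of "space (data_space n {..<k}) - B" k] B by simp
    qed
    ultimately show ?thesis
      using cylinder_risk_lower_bound[OF m \<C> sensing B] by simp
  qed
  moreover have "risk \<C> ?P \<Phi> = measure (?P {}) ?D + Max ((\<lambda>S. measure (?P S) (?\<Omega> - ?D)) ` \<C>)"
    by (simp only: risk_def data_law_simps Dc)
  ultimately show "exp (- (\<mu>\<^sup>2 * s * m / (2 * real (card (\<Union>\<C>))))) / 2 \<le> risk \<C> ?P \<Phi> + e"
    by linarith
qed

theorem theorem3p1: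
  fixes n s :: nat and m \<mu> \<epsilon> :: real and \<C> :: "nat set set"
    and \<A> :: "nat \<Rightarrow> (nat \<Rightarrow> real \<times> nat \<times> real) \<Rightarrow> (nat \<times> real) measure"
    and M :: "nat set \<Rightarrow> 'w measure"
    and Y :: "nat set \<Rightarrow> nat \<Rightarrow> 'w \<Rightarrow> real" and A :: "nat set \<Rightarrow> nat \<Rightarrow> 'w \<Rightarrow> nat"
    and \<Gamma> :: "nat set \<Rightarrow> nat \<Rightarrow> 'w \<Rightarrow> real" and W :: "nat set \<Rightarrow> nat \<Rightarrow> 'w \<Rightarrow> real"
    and \<Phi> :: "(nat \<Rightarrow> real \<times> nat \<times> real) \<Rightarrow> nat"
  assumes "n \<ge> 1" and "1 \<le> s" and "s \<le> n" and "m > 0" and "\<mu> > 0"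
    and "symmetric_class n s \<C>"
    and "\<And>S. S \<in> insert {} \<C> \<Longrightarrow>
           adaptive_sensing (M S) n m (signal \<mu> S) \<A> (Y S) (A S) (\<Gamma> S) (W S)"
    and "\<Phi> \<in> data_space n UNIV \<rightarrow>\<^sub>M count_space {0, 1}"
    and "0 < \<epsilon>" and "\<epsilon> < 1"
    and "risk \<C> (\<lambda>S. data_law n (M S) (Y S) (A S) (\<Gamma> S)) \<Phi> \<le> \<epsilon>"
  shows "\<forall>S\<in>\<C>. x_min n (signal \<mu> S)
           \<ge> sqrt (2 * real (card (\<Union>\<C>)) / (real s * m) * ln (1 / (2 * \<epsilon>)))"
proof
  fix S assume S: "S \<in> \<C>"
  then have "S \<subseteq> {1..n}" "S \<noteq> {}" and sub: "\<Union>\<C> \<subseteq> {1..n}"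
    using assms(2,6) by (auto simp: symmetric_class_def)
  then have x: "x_min n (signal \<mu> S) = \<mu>" using \<open>\<mu> > 0\<close> by (intro x_min_signal)
  have \<Xi>: "real (card (\<Union>\<C>)) > 0"
    using S \<open>S \<noteq> {}\<close> finite_subset[OF sub] by (auto simp: card_gt_0_iff)
  \<comment> \<open>\<open>K\<close> is the bound on the average divergence; the 2 in its
    denominator and the factor 1/2 in front of \<open>exp (- K)\<close> become the two constants 2
    of the claim.\<close>
  define K where "K = \<mu>\<^sup>2 * s * m / (2 * real (card (\<Union>\<C>)))"
  have "exp (- K) / 2 \<le> \<epsilon>"
    using risk_lower_bound[OF assms(4,6,7,8)] assms(11) unfolding K_def by linarith
  then have "1 / (2 * \<epsilon>) \<le> exp K" using \<open>0 < \<epsilon>\<close> by (simp add: exp_minus field_simps)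
  then have "ln (1 / (2 * \<epsilon>)) \<le> ln (exp K)" using \<open>0 < \<epsilon>\<close> by (intro ln_mono) auto
  then have "2 * real (card (\<Union>\<C>)) / (real s * m) * ln (1 / (2 * \<epsilon>))
      \<le> 2 * real (card (\<Union>\<C>)) / (real s * m) * K"
    using \<open>m > 0\<close> by (intro mult_left_mono) auto
  also have "\<dots> = \<mu>\<^sup>2" using \<Xi> assms(2,4) by (simp add: K_def)
  \<comment> \<open>\<open>sqrt\<close> is monotone on all reals and negative at negative arguments,
    so for \<open>\<epsilon> > 1 / 2\<close> the same step yields the vacuous bound without a case
    split.\<close>
  finally have "sqrt (2 * real (card (\<Union>\<C>)) / (real s * m) * ln (1 / (2 * \<epsilon>))) \<le> sqrt (\<mu>\<^sup>2)"
    by (rule real_sqrt_le_mono)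
  then show "x_min n (signal \<mu> S) \<ge> sqrt (2 * real (card (\<Union>\<C>)) / (real s * m) * ln (1 / (2 * \<epsilon>)))"
    using \<open>\<mu> > 0\<close> by (simp add: x)
qed

end
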